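(* Let $d\ge1$, let $S\subseteq C_d=\mathbb Z/d\mathbb Z$ with $0\in S$, let $S_3,S_4\subseteq S\setminus\{0\}$ be disjoint, and specialize the parameters of the trace $\mathrm{Tr}$ on $\mathrm Y^{\mathtt B}_{d,n}(\mathsf u,\mathsf v)$ to $$x_k=\frac1{|S|}\sum_{m\in S}\chi_m(k),\qquad z=-\frac1{\mathsf u(\mathsf u^2+1)|S|},\qquad y_k=\frac{\mathsf v^2-1}{\mathsf v(\mathsf u^2+1)|S|}\chi_0(k)+\frac1{|S|}\Big(\sum_{m\in S_3}\chi_m(k)-\sum_{m\in S_4}\chi_m(k)\Big).$$ With $\mathrm E_S=1/|S|$, for $\alpha\in\mathcal F^{\mathtt B}_{d,n}$ put $$\rho_S^{\mathtt B}(\mathsf u,\mathsf v)(\widehat\alpha):=\Big(-\frac{1+\mathsf u^2}{\mathrm E_S\,\mathsf u}\Big)^{n-1}\mathsf u^{2\varepsilon(\alpha)}\,\mathrm{Tr}(\bar\pi(\alpha)).$$ Then $\rho_S^{\mathtt B}$ is an invariant of framed links inside the solid torus; that is, its value depends only on the equivalence class of $\alpha\in\bigcup_n\mathcal F^{\mathtt B}_{d,n}$ under the equivalence relation generated by conjugation in each group $\mathcal F^{\mathtt B}_{d,n}$ and the stabilization moves $\mathcal F^{\mathtt B}_{d,n}\ni\alpha\sim\alpha\sigma_n^{\pm1}\in\mathcal F^{\mathtt B}_{d,n+1}$.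
   Context: $\mathsf u,\mathsf v$ are indeterminates and $\mathbb K=\mathbb C(\mathsf u,\mathsf v)$. $\chi_k(a)=e^{2\pi ika/d}$ are the characters of $C_d=\mathbb Z/d\mathbb Z$. Braid group of type $\mathtt B_n$: $\widetilde W_n$ is generated by $\rho_1,\sigma_1,\dots,\sigma_{n-1}$ with $\sigma_i\sigma_j=\sigma_j\sigma_i$ ($|i-j|>1$), $\sigma_i\sigma_j\sigma_i=\sigma_j\sigma_i\sigma_j$ ($|i-j|=1$), $\rho_1\sigma_i=\sigma_i\rho_1$ ($i>1$), $\rho_1\sigma_1\rho_1\sigma_1=\sigma_1\rho_1\sigma_1\rho_1$. The $d$-modular framed braid group of type $\mathtt B_n$ is $\mathcal F^{\mathtt B}_{d,n}=(\mathbb Z/d\mathbb Z)^n\rtimes\widetilde W_n$, with the framing generators $t_1,\dots,t_n$ of order $d$ satisfying $t_j\sigma_i=\sigma_it_{s_i(j)}$, $s_i=(i,i+1)$, and $t_i\rho_1=\rho_1t_i$. $\varepsilon(\alpha)$ is the algebraic sum of the exponents of the $\sigma_i$'s in $\alpha$. By the framed Markov theorem for the solid torus, ($d$-modular) framed links in the solid torus, i.e. closures $\widehat\alpha$, correspond to classes of $\bigcup_n\mathcal F^{\mathtt B}_{d,n}$ under the equivalence relation described in the claim. Yokonuma-Hecke algebra of type $\mathtt B$: $\mathrm Y^{\mathtt B}_{d,n}(\mathsf u,\mathsf v)$ is the $\mathbb K$-algebra generated by $t_1,\dots,t_n,g_1,\dots,g_{n-1},b_1$ with relations: $g_ig_j=g_jg_i$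 for $|i-j|>1$; $g_ig_jg_i=g_jg_ig_j$ for $|i-j|=1$; $b_1g_i=g_ib_1$ for $i\ne1$; $b_1g_1b_1g_1=g_1b_1g_1b_1$; $t_it_j=t_jt_i$; $t_jg_i=g_it_{s_i(j)}$; $t_ib_1=b_1t_i$; $t_i^d=1$; $g_i^2=1+(\mathsf u-\mathsf u^{-1})e_ig_i$; $b_1^2=1+(\mathsf v-\mathsf v^{-1})f_1b_1$, where $e_i=\frac1d\sum_{s=0}^{d-1}t_i^st_{i+1}^{-s}$, $f_i=\frac1d\sum_{k=0}^{d-1}t_i^k$. Put $b_k:=g_{k-1}\cdots g_1b_1g_1^{-1}\cdots g_{k-1}^{-1}$. Markov trace (a known result): for any parameters $z,x_1,\dots,x_{d-1},y_0,\dots,y_{d-1}$, $x_0:=1$, there is a unique family of linear maps $\mathrm{Tr}=\mathrm{Tr}_n$ on $\mathrm Y^{\mathtt B}_{d,n}$ with $\mathrm{Tr}_n(1)=1$; $\mathrm{Tr}_{n+1}(Xg_n)=z\mathrm{Tr}_n(X)$; $\mathrm{Tr}_{n+1}(Xb_{n+1}t_{n+1}^m)=y_m\mathrm{Tr}_n(X)$; $\mathrm{Tr}_{n+1}(Xt_{n+1}^m)=x_m\mathrm{Tr}_n(X)$; $\mathrm{Tr}_n(XY)=\mathrm{Tr}_n(YX)$, for $X,Y\in\mathrm Y^{\mathtt B}_{d,n}$ (with $\mathrm{Tr}_1(t_1^m)=x_m$, $\mathrm{Tr}_1(b_1t_1^m)=y_m$). For the parameter values in the claim, $\mathrm{Tr}$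 vanishes on the two-sided ideal generated by $r_{1,2}=e_1e_2g_{1,2}$ and $r_{\mathtt B}=f_1e_1g_{\mathtt B}$, where $g_{1,2}=1+\mathsf u(g_1+g_2)+\mathsf u^2(g_1g_2+g_2g_1)+\mathsf u^3g_1g_2g_1$ and $g_{\mathtt B}=1+\mathsf ug_1+\mathsf vb_1+\mathsf u\mathsf v(g_1b_1+b_1g_1)+\mathsf u^2\mathsf v\,g_1b_1g_1+\mathsf v^2\mathsf u\,b_1g_1b_1+(\mathsf u\mathsf v)^2g_1b_1g_1b_1$, so it induces a trace, also written $\mathrm{Tr}$, on $\mathrm{FTL}^{\mathtt B}_{d,n}(\mathsf u,\mathsf v)=\mathrm Y^{\mathtt B}_{d,n}(\mathsf u,\mathsf v)/\langle r_{\mathtt B},r_{1,2}\rangle$. The map $\bar\pi:\mathcal F^{\mathtt B}_{d,n}\to\mathrm{FTL}^{\mathtt B}_{d,n}(\mathsf u,\mathsf v)$ sends $\sigma_i\mapsto g_i$, $\rho_1\mapsto b_1$, $t_i\mapsto t_i$ (so $\mathrm{Tr}(\bar\pi(\alpha))$ is the value of $\mathrm{Tr}$ on the image of $\alpha$ in $\mathrm Y^{\mathtt B}_{d,n}$). *)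

theory Defs
  imports
    Complex_Main
    "HOL-Computational_Algebra.Fraction_Field"
    "HOL-Computational_Algebra.Polynomial"
    "HOL-Library.Poly_Mapping"
    "HOL-Combinatorics.Transposition"
    "HOL-Algebra.QuotRing"
    "HOL-Algebra.Module"
begin

section \<open>The ground field\<close>

text \<open>\<open>\<complex>(u,v)\<close> is the fraction field of \<open>\<complex>[u][v]\<close>: the inner polynomial variable is \<open>u\<close>,
  the outer one is \<open>v\<close>.\<close>

type_synonym cuv = "complex poly poly fract"

definition ind_u :: cuv where "ind_u = Fraction_Field.Fract [:[:0, 1:]:] 1"
definition ind_v :: cuv where "ind_v = Fraction_Field.Fract [:0, 1:] 1"
definition const_cuv :: "complex \<Rightarrow> cuv" where "const_cuv c = Fraction_Field.Fract [:[:c:]:] 1"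

text \<open>Elements of \<open>\<int>/d\<int>\<close> are represented by naturals below \<open>d\<close>.\<close>

definition chi :: "nat \<Rightarrow> nat \<Rightarrow> nat \<Rightarrow> cuv" where
  "chi d k a = const_cuv (exp (2 * complex_of_real pi * \<i> * of_nat k * of_nat a / of_nat d))"


section \<open>Groups by generators and relations\<close>

text \<open>A letter \<open>(g, True)\<close> stands for the generator \<open>g\<close>, a letter \<open>(g, False)\<close> for its inverse.\<close>

inductive pres_cong ::
    "'g set \<Rightarrow> (('g \<times> bool) list \<times> ('g \<times> bool) list) set \<Rightarrow>
     ('g \<times> bool) list \<Rightarrow> ('g \<times> bool) list \<Rightarrow> bool"
  for X R where
  pc_refl: "w \<in> lists (X \<times> UNIV) \<Longrightarrow> pres_cong X R w w"
| pc_sym: "pres_cong X R v w \<Longrightarrow> pres_cong X R w v"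
| pc_trans: "pres_cong X R u v \<Longrightarrow> pres_cong X R v w \<Longrightarrow> pres_cong X R u w"
| pc_cancel: "a \<in> lists (X \<times> UNIV) \<Longrightarrow> b \<in> lists (X \<times> UNIV) \<Longrightarrow> g \<in> X \<Longrightarrow>
    pres_cong X R (a @ [(g, s), (g, \<not> s)] @ b) (a @ b)"
| pc_rel: "a \<in> lists (X \<times> UNIV) \<Longrightarrow> b \<in> lists (X \<times> UNIV) \<Longrightarrow> (l, r) \<in> R \<Longrightarrow>
    pres_cong X R (a @ l @ b) (a @ r @ b)"

definition pres_rel where "pres_rel X R = {(v, w). pres_cong X R v w}"

definition presented_group ::
    "'g set \<Rightarrow> (('g \<times> bool) list \<times> ('g \<times> bool) list) set \<Rightarrow> ('g \<times> bool) list set monoid" where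
  "presented_group X R =
    \<lparr>carrier = lists (X \<times> UNIV) // pres_rel X R,
     mult = (\<lambda>A B. \<Union>v\<in>A. \<Union>w\<in>B. pres_rel X R `` {v @ w}),
     one = pres_rel X R `` {[]}\<rparr>"

definition eval_word :: "('a, 'm) monoid_scheme \<Rightarrow> ('g \<Rightarrow> 'a) \<Rightarrow> ('g \<times> bool) list \<Rightarrow> 'a" where
  "eval_word M \<phi> w =
    foldr (\<lambda>(g, s) x. (if s then \<phi> g else inv\<^bsub>M\<^esub> (\<phi> g)) \<otimes>\<^bsub>M\<^esub> x) w \<one>\<^bsub>M\<^esub>"

text \<open>The homomorphism from a presented group to the units of \<open>M\<close> given by \<open>\<phi>\<close> on generators:
  the common value on all words of a class.\<close>

definition pres_hom :: "('a, 'm) monoid_scheme \<Rightarrow> ('g \<Rightarrow> 'a) \<Rightarrow> ('g \<times> bool) list set \<Rightarrow> 'a" where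
  "pres_hom M \<phi> \<alpha> = the_elem (eval_word M \<phi> ` \<alpha>)"


section \<open>Algebras by generators and relations\<close>

text \<open>Words form a free monoid, written additively (but not commutative) so that
  \<open>'g gword \<Rightarrow>\<^sub>0 'k\<close> carries the convolution product: it is the free algebra.\<close>

datatype 'g gword = GWord (letters: "'g list")

instantiation gword :: (type) monoid_add
begin

definition zero_gword :: "'a gword" where "0 = GWord []"
definition plus_gword :: "'a gword \<Rightarrow> 'a gword \<Rightarrow> 'a gword" where
  "v + w = GWord (letters v @ letters w)"

instance
  by standard (simp_all add: zero_gword_def plus_gword_def)

end

definition word_mono :: "'g list \<Rightarrow> 'g gword \<Rightarrow>\<^sub>0 'k::comm_ring_1" where
  "word_mono w = Poly_Mapping.single (GWord w) 1"

definition scalar :: "'k \<Rightarrow> 'g gword \<Rightarrow>\<^sub>0 'k::comm_ring_1" where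
  "scalar c = Poly_Mapping.single 0 c"

definition free_algebra :: "'g set \<Rightarrow> ('k::comm_ring_1, 'g gword \<Rightarrow>\<^sub>0 'k) module" where
  "free_algebra X =
    \<lparr>carrier = {f. \<forall>w\<in>Poly_Mapping.keys f. set (letters w) \<subseteq> X},
     mult = (*), one = 1, zero = 0, add = (+), smult = (\<lambda>c f. scalar c * f)\<rparr>"

definition quot_algebra :: "('k, 'a, 'm) module_scheme \<Rightarrow> 'a set \<Rightarrow> ('k, 'a set) module" where
  "quot_algebra A I =
    ring.extend (A Quot I) (module.fields (\<lambda>c X. \<Union>x\<in>X. I +>\<^bsub>A\<^esub> (c \<odot>\<^bsub>A\<^esub> x)))"

definition relation_ideal ::
    "'g set \<Rightarrow> (('g gword \<Rightarrow>\<^sub>0 'k::comm_ring_1) \<times> ('g gword \<Rightarrow>\<^sub>0 'k)) set \<Rightarrow>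
     ('g gword \<Rightarrow>\<^sub>0 'k) set" where
  "relation_ideal X R = genideal (free_algebra X :: ('k, _) module) {l - r | l r. (l, r) \<in> R}"


section \<open>The framed braid group of type B\<close>

datatype gen = Framing nat | Braiding nat | Loop

definition gens :: "nat \<Rightarrow> gen set" where
  "gens n = Framing ` {1..n} \<union> Braiding ` {1..<n} \<union> {Loop}"

text \<open>The relations shared by the framed braid group and the Yokonuma-Hecke algebra; all of them
  are equalities of positive words.\<close>

inductive_set framed_rels :: "nat \<Rightarrow> nat \<Rightarrow> (gen list \<times> gen list) set" for d n where
  far: "\<lbrakk>i \<in> {1..<n}; j \<in> {1..<n}; i + 1 < j \<or> j + 1 < i\<rbrakk> \<Longrightarrow>
    ([Braiding i, Braiding j], [Braiding j, Braiding i]) \<in> framed_rels d n"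
| braid: "\<lbrakk>i \<in> {1..<n}; j \<in> {1..<n}; i + 1 = j \<or> j + 1 = i\<rbrakk> \<Longrightarrow>
    ([Braiding i, Braiding j, Braiding i], [Braiding j, Braiding i, Braiding j]) \<in> framed_rels d n"
| loop_far: "\<lbrakk>i \<in> {1..<n}; i > 1\<rbrakk> \<Longrightarrow>
    ([Loop, Braiding i], [Braiding i, Loop]) \<in> framed_rels d n"
| loop_braid: "1 \<in> {1..<n} \<Longrightarrow>
    ([Loop, Braiding 1, Loop, Braiding 1], [Braiding 1, Loop, Braiding 1, Loop]) \<in> framed_rels d n"
| framing_comm: "\<lbrakk>i \<in> {1..n}; j \<in> {1..n}\<rbrakk> \<Longrightarrow>
    ([Framing i, Framing j], [Framing j, Framing i]) \<in> framed_rels d n"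
| framing_order: "j \<in> {1..n} \<Longrightarrow> (replicate d (Framing j), []) \<in> framed_rels d n"
| framing_braid: "\<lbrakk>i \<in> {1..<n}; j \<in> {1..n}\<rbrakk> \<Longrightarrow>
    ([Framing j, Braiding i], [Braiding i, Framing (Transposition.transpose i (i + 1) j)])
      \<in> framed_rels d n"
| framing_loop: "i \<in> {1..n} \<Longrightarrow>
    ([Framing i, Loop], [Loop, Framing i]) \<in> framed_rels d n"

abbreviation pos_word :: "gen list \<Rightarrow> (gen \<times> bool) list" where
  "pos_word \<equiv> map (\<lambda>g. (g, True))"

type_synonym fbraid = "(gen \<times> bool) list set"

definition fbraid_rels :: "nat \<Rightarrow> nat \<Rightarrow> ((gen \<times> bool) list \<times> (gen \<times> bool) list) set" where
  "fbraid_rels d n = map_prod pos_word pos_word ` framed_rels d n"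

definition fbraid_group :: "nat \<Rightarrow> nat \<Rightarrow> fbraid monoid" where
  "fbraid_group d n = presented_group (gens n) (fbraid_rels d n)"

definition fbraid_gen :: "nat \<Rightarrow> nat \<Rightarrow> gen \<Rightarrow> fbraid" where
  "fbraid_gen d n g = pres_rel (gens n) (fbraid_rels d n) `` {[(g, True)]}"

text \<open>The natural map from the group on \<open>n\<close> strands to the group on \<open>n + 1\<close> strands.\<close>

definition fbraid_incl :: "nat \<Rightarrow> nat \<Rightarrow> fbraid \<Rightarrow> fbraid" where
  "fbraid_incl d n \<alpha> = (\<Union>w\<in>\<alpha>. pres_rel (gens (n + 1)) (fbraid_rels d (n + 1)) `` {w})"

definition word_exp :: "(gen \<times> bool) list \<Rightarrow> int" where
  "word_exp w =
    sum_list (map (\<lambda>(g, s). case g of Braiding i \<Rightarrow> (if s then 1 else - 1) | _ \<Rightarrow> 0) w)"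

definition exp_sum :: "fbraid \<Rightarrow> int" where
  "exp_sum \<alpha> = the_elem (word_exp ` \<alpha>)"

text \<open>Framed braids are paired with their number of strands.\<close>

inductive markov_move :: "nat \<Rightarrow> nat \<times> fbraid \<Rightarrow> nat \<times> fbraid \<Rightarrow> bool" for d where
  conjugation: "\<lbrakk>n \<ge> 1; \<alpha> \<in> carrier (fbraid_group d n); \<gamma> \<in> carrier (fbraid_group d n)\<rbrakk> \<Longrightarrow>
    markov_move d (n, \<alpha>)
      (n, \<gamma> \<otimes>\<^bsub>fbraid_group d n\<^esub> \<alpha> \<otimes>\<^bsub>fbraid_group d n\<^esub> inv\<^bsub>fbraid_group d n\<^esub> \<gamma>)"
| stab_pos: "\<lbrakk>n \<ge> 1; \<alpha> \<in> carrier (fbraid_group d n)\<rbrakk> \<Longrightarrow>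
    markov_move d (n, \<alpha>)
      (n + 1, fbraid_incl d n \<alpha> \<otimes>\<^bsub>fbraid_group d (n + 1)\<^esub> fbraid_gen d (n + 1) (Braiding n))"
| stab_neg: "\<lbrakk>n \<ge> 1; \<alpha> \<in> carrier (fbraid_group d n)\<rbrakk> \<Longrightarrow>
    markov_move d (n, \<alpha>)
      (n + 1, fbraid_incl d n \<alpha> \<otimes>\<^bsub>fbraid_group d (n + 1)\<^esub>
        inv\<^bsub>fbraid_group d (n + 1)\<^esub> fbraid_gen d (n + 1) (Braiding n))"

definition solid_torus_invariant :: "nat \<Rightarrow> (nat \<times> fbraid \<Rightarrow> 'a) \<Rightarrow> bool" where
  "solid_torus_invariant d F \<longleftrightarrow> (\<forall>p q. equivclp (markov_move d) p q \<longrightarrow> F p = F q)"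


section \<open>The Yokonuma-Hecke algebra of type B\<close>

type_synonym free_el = "gen gword \<Rightarrow>\<^sub>0 cuv"

abbreviation ft :: "nat \<Rightarrow> free_el" where "ft j \<equiv> word_mono [Framing j]"
abbreviation fg :: "nat \<Rightarrow> free_el" where "fg i \<equiv> word_mono [Braiding i]"
abbreviation fb :: "free_el" where "fb \<equiv> word_mono [Loop]"

text \<open>As \<open>t\<^sup>d = 1\<close> in the quotient, \<open>t\<^sup>-\<^sup>s\<close> is written \<open>t\<^sup>d\<^sup>-\<^sup>s\<close>.\<close>

definition idem_e :: "nat \<Rightarrow> nat \<Rightarrow> free_el" where
  "idem_e d i = scalar (1 / of_nat d) * (\<Sum>s<d. ft i ^ s * ft (i + 1) ^ (d - s))"

definition idem_f :: "nat \<Rightarrow> nat \<Rightarrow> free_el" where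
  "idem_f d i = scalar (1 / of_nat d) * (\<Sum>k<d. ft i ^ k)"

definition yokonuma_rels :: "nat \<Rightarrow> nat \<Rightarrow> (free_el \<times> free_el) set" where
  "yokonuma_rels d n =
    map_prod word_mono word_mono ` framed_rels d n \<union>
    {(fg i ^ 2, 1 + scalar (ind_u - inverse ind_u) * idem_e d i * fg i) | i. i \<in> {1..<n}} \<union>
    {(fb ^ 2, 1 + scalar (ind_v - inverse ind_v) * idem_f d 1 * fb)}"

definition yokonuma_ideal :: "nat \<Rightarrow> nat \<Rightarrow> free_el set" where
  "yokonuma_ideal d n = relation_ideal (gens n) (yokonuma_rels d n)"

definition yokonuma :: "nat \<Rightarrow> nat \<Rightarrow> (cuv, free_el set) module" where
  "yokonuma d n = quot_algebra (free_algebra (gens n)) (yokonuma_ideal d n)"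

definition yok_class :: "nat \<Rightarrow> nat \<Rightarrow> free_el \<Rightarrow> free_el set" where
  "yok_class d n x = yokonuma_ideal d n +>\<^bsub>(free_algebra (gens n) :: (cuv, free_el) module)\<^esub> x"

definition yok_gen :: "nat \<Rightarrow> nat \<Rightarrow> gen \<Rightarrow> free_el set" where
  "yok_gen d n g = yok_class d n (word_mono [g])"

definition yok_incl :: "nat \<Rightarrow> nat \<Rightarrow> free_el set \<Rightarrow> free_el set" where
  "yok_incl d n X = (\<Union>x\<in>X. yok_class d (n + 1) x)"

text \<open>\<open>loop_conj d n k\<close> is the element \<open>b\<^sub>k\<close> of the algebra on \<open>n\<close> strands
  (the value at \<open>k = 0\<close> is irrelevant).\<close>

fun loop_conj :: "nat \<Rightarrow> nat \<Rightarrow> nat \<Rightarrow> free_el set" where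
  "loop_conj d n 0 = yok_gen d n Loop"
| "loop_conj d n (Suc 0) = yok_gen d n Loop"
| "loop_conj d n (Suc (Suc k)) =
    yok_gen d n (Braiding (Suc k)) \<otimes>\<^bsub>yokonuma d n\<^esub> loop_conj d n (Suc k)
      \<otimes>\<^bsub>yokonuma d n\<^esub> inv\<^bsub>yokonuma d n\<^esub> yok_gen d n (Braiding (Suc k))"

definition linear_functional :: "('k::comm_ring_1, 'a, 'm) module_scheme \<Rightarrow> ('a \<Rightarrow> 'k) \<Rightarrow> bool" where
  "linear_functional A f \<longleftrightarrow>
    (\<forall>X\<in>carrier A. \<forall>Y\<in>carrier A. f (X \<oplus>\<^bsub>A\<^esub> Y) = f X + f Y) \<and>
    (\<forall>c. \<forall>X\<in>carrier A. f (c \<odot>\<^bsub>A\<^esub> X) = c * f X)"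

definition markov_trace ::
    "nat \<Rightarrow> cuv \<Rightarrow> (nat \<Rightarrow> cuv) \<Rightarrow> (nat \<Rightarrow> cuv) \<Rightarrow> (nat \<Rightarrow> free_el set \<Rightarrow> cuv) \<Rightarrow> bool" where
  "markov_trace d z x y Tr \<longleftrightarrow>
    (\<forall>n\<ge>1. linear_functional (yokonuma d n) (Tr n)) \<and>
    (\<forall>n\<ge>1. Tr n \<one>\<^bsub>yokonuma d n\<^esub> = 1) \<and>
    (\<forall>n\<ge>1. \<forall>X\<in>carrier (yokonuma d n).
      Tr (n + 1) (yok_incl d n X \<otimes>\<^bsub>yokonuma d (n + 1)\<^esub> yok_gen d (n + 1) (Braiding n))
        = z * Tr n X) \<and>
    (\<forall>n\<ge>1. \<forall>X\<in>carrier (yokonuma d n). \<forall>m<d.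
      Tr (n + 1) (yok_incl d n X \<otimes>\<^bsub>yokonuma d (n + 1)\<^esub> loop_conj d (n + 1) (n + 1)
          \<otimes>\<^bsub>yokonuma d (n + 1)\<^esub> yok_gen d (n + 1) (Framing (n + 1)) [^]\<^bsub>yokonuma d (n + 1)\<^esub> m)
        = y m * Tr n X) \<and>
    (\<forall>n\<ge>1. \<forall>X\<in>carrier (yokonuma d n). \<forall>m<d.
      Tr (n + 1) (yok_incl d n X
          \<otimes>\<^bsub>yokonuma d (n + 1)\<^esub> yok_gen d (n + 1) (Framing (n + 1)) [^]\<^bsub>yokonuma d (n + 1)\<^esub> m)
        = x m * Tr n X) \<and>
    (\<forall>n\<ge>1. \<forall>X\<in>carrier (yokonuma d n). \<forall>Y\<in>carrier (yokonuma d n).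
      Tr n (X \<otimes>\<^bsub>yokonuma d n\<^esub> Y) = Tr n (Y \<otimes>\<^bsub>yokonuma d n\<^esub> X)) \<and>
    (\<forall>m<d. Tr 1 (yok_gen d 1 (Framing 1) [^]\<^bsub>yokonuma d 1\<^esub> m) = x m) \<and>
    (\<forall>m<d. Tr 1 (yok_gen d 1 Loop \<otimes>\<^bsub>yokonuma d 1\<^esub>
        yok_gen d 1 (Framing 1) [^]\<^bsub>yokonuma d 1\<^esub> m) = y m)"

definition yok_hom :: "nat \<Rightarrow> nat \<Rightarrow> fbraid \<Rightarrow> free_el set" where
  "yok_hom d n = pres_hom (yokonuma d n) (yok_gen d n)"


section \<open>The framed Temperley-Lieb quotient\<close>

definition r_TL :: "nat \<Rightarrow> free_el" where
  "r_TL d = idem_e d 1 * idem_e d 2 *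
    (1 + scalar ind_u * (fg 1 + fg 2) + scalar (ind_u ^ 2) * (fg 1 * fg 2 + fg 2 * fg 1)
       + scalar (ind_u ^ 3) * (fg 1 * fg 2 * fg 1))"

definition r_B :: "nat \<Rightarrow> free_el" where
  "r_B d = idem_f d 1 * idem_e d 1 *
    (1 + scalar ind_u * fg 1 + scalar ind_v * fb
       + scalar (ind_u * ind_v) * (fg 1 * fb + fb * fg 1)
       + scalar (ind_u ^ 2 * ind_v) * (fg 1 * fb * fg 1)
       + scalar (ind_v ^ 2 * ind_u) * (fb * fg 1 * fb)
       + scalar ((ind_u * ind_v) ^ 2) * (fg 1 * fb * fg 1 * fb))"

text \<open>The generator \<open>r_B\<close> only makes sense for \<open>n \<ge> 2\<close>, and \<open>r_TL\<close> only for \<open>n \<ge> 3\<close>.\<close>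

definition ftl_ideal :: "nat \<Rightarrow> nat \<Rightarrow> free_el set set" where
  "ftl_ideal d n = genideal (yokonuma d n)
    ((if n \<ge> 2 then {yok_class d n (r_B d)} else {}) \<union>
     (if n \<ge> 3 then {yok_class d n (r_TL d)} else {}))"

definition ftl :: "nat \<Rightarrow> nat \<Rightarrow> (cuv, free_el set set) module" where
  "ftl d n = quot_algebra (yokonuma d n) (ftl_ideal d n)"

definition ftl_class :: "nat \<Rightarrow> nat \<Rightarrow> free_el set \<Rightarrow> free_el set set" where
  "ftl_class d n X = ftl_ideal d n +>\<^bsub>yokonuma d n\<^esub> X"

definition ftl_hom :: "nat \<Rightarrow> nat \<Rightarrow> fbraid \<Rightarrow> free_el set set" where
  "ftl_hom d n = pres_hom (ftl d n) (\<lambda>g. ftl_class d n (yok_gen d n g))"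

definition induced_on_ftl ::
    "nat \<Rightarrow> (nat \<Rightarrow> free_el set \<Rightarrow> cuv) \<Rightarrow> (nat \<Rightarrow> free_el set set \<Rightarrow> cuv) \<Rightarrow> bool" where
  "induced_on_ftl d Tr tr \<longleftrightarrow>
    (\<forall>n\<ge>1. \<forall>X\<in>carrier (yokonuma d n). tr n (ftl_class d n X) = Tr n X)"


section \<open>The parameters and the normalised trace\<close>

definition E_par :: "nat set \<Rightarrow> cuv" where
  "E_par S = 1 / of_nat (card S)"

definition x_par :: "nat \<Rightarrow> nat set \<Rightarrow> nat \<Rightarrow> cuv" where
  "x_par d S k = 1 / of_nat (card S) * (\<Sum>m\<in>S. chi d m k)"

definition z_par :: "nat set \<Rightarrow> cuv" where
  "z_par S = - (1 / (ind_u * (ind_u ^ 2 + 1) * of_nat (card S)))"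

definition y_par :: "nat \<Rightarrow> nat set \<Rightarrow> nat set \<Rightarrow> nat set \<Rightarrow> nat \<Rightarrow> cuv" where
  "y_par d S S3 S4 k =
    (ind_v ^ 2 - 1) / (ind_v * (ind_u ^ 2 + 1) * of_nat (card S)) * chi d 0 k
    + 1 / of_nat (card S) * ((\<Sum>m\<in>S3. chi d m k) - (\<Sum>m\<in>S4. chi d m k))"

text \<open>\<open>T n \<alpha>\<close> is the trace of the image of \<open>\<alpha>\<close> in the algebra on \<open>n\<close> strands.\<close>

definition rho_B :: "nat set \<Rightarrow> (nat \<Rightarrow> fbraid \<Rightarrow> cuv) \<Rightarrow> nat \<times> fbraid \<Rightarrow> cuv" where
  "rho_B S T = (\<lambda>(n, \<alpha>).
    (- ((1 + ind_u ^ 2) / (E_par S * ind_u))) ^ (n - 1) * ind_u powi (2 * exp_sum \<alpha>) * T n \<alpha>)"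

end

(* Conjugation and positive stabilization follow at once from the trace rules. Since
   g_n^(-1) = g_n - (u - 1/u) e_n, negative stabilization needs Tr(a e_n) = E_S Tr(a) for a on n
   strands. By the choice of the x_k this says that Tr_n annihilates a eps_m(t_n) whenever m is not
   in S, where eps_m(t_j) is the idempotent of t_j belonging to the character chi_m. Conjugating by
   the g_j one may replace t_n by t_1, and then argue by induction on n: the algebra on n + 1 strands
   is spanned by a t_(n+1)^k, a b_(n+1) t_(n+1)^k and a g_n a' with a, a' on n strands, and on each
   of these the trace rules reduce the claim to n strands. For n = 1 it is orthogonality of characters.
   Spanning is first shown with the Jucys-Murphy type element g_n ... g_1 b_1 g_1 ... g_n in place
   of b_(n+1), because it commutes with the algebra on n strands. *)

theory Submission
  imports Defs "HOL-Analysis.Complex_Transcendental"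
begin

section \<open>Calculus modulo the Yokonuma-Hecke relations\<close>

text \<open>All computations take place on representatives in the free algebra, modulo a congruence
  that records the rank. The map from n to n + 1 strands is then the identity on representatives,
  and a relation proved in low rank may be used in every higher one. Why t_1 and not t_n in the
  vanishing statement: \<open>char_idem m 1\<close> lies in the algebra on n strands for every n >=
  1, so each trace rule can strip off the last strand and leave it untouched, whereas
  \<open>char_idem m (Suc n)\<close> involves that very strand. Why the given x and y satisfy what
  is left on one strand: they are Fourier transforms on Z/dZ, x of 1/|S| times the indicator of S, y
  of a function supported on {0}, S3 and S4, hence on S. Neither has a component along chi_m for m
  outside S. The obstacle is to close the span under right multiplication: a factor on n strands
  standing to the right has to be moved into the left coefficient.\<close>

abbreviation free_on :: "nat \<Rightarrow> free_el set" where
  "free_on n \<equiv> carrier (free_algebra (gens n) :: (cuv, free_el) module)"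

abbreviation gen_el :: "gen \<Rightarrow> free_el" where "gen_el g \<equiv> word_mono [g]"

section \<open>The free algebra on the generators of rank n\<close>

lemma free_on_iff: "x \<in> free_on n \<longleftrightarrow> (\<forall>w\<in>Poly_Mapping.keys x. set (letters w) \<subseteq> gens n)"
  by (simp add: free_algebra_def)

lemma free_on_0 [simp]: "0 \<in> free_on n"
  by (simp add: free_on_iff)

lemma free_on_word [simp]: "set w \<subseteq> gens n \<Longrightarrow> word_mono w \<in> free_on n"
  by (simp add: free_on_iff word_mono_def)

lemma free_on_scalar [simp]: "scalar c \<in> free_on n"
  by (cases "c = 0") (simp_all add: free_on_iff scalar_def zero_gword_def)

lemma scalar_1 [simp]: "scalar 1 = 1" and scalar_0 [simp]: "scalar 0 = 0"
  by (simp_all add: scalar_def)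

lemma free_on_1 [simp]: "1 \<in> free_on n"
  using free_on_scalar[of 1 n] by simp

lemma free_on_add [simp]: "x \<in> free_on n \<Longrightarrow> y \<in> free_on n \<Longrightarrow> x + y \<in> free_on n"
  unfolding free_on_iff using keys_add[of x y] by blast

lemma free_on_uminus [simp]: "x \<in> free_on n \<Longrightarrow> - x \<in> free_on n"
  by (simp add: free_on_iff)

lemma free_on_diff [simp]: "x \<in> free_on n \<Longrightarrow> y \<in> free_on n \<Longrightarrow> x - y \<in> free_on n"
  using free_on_add[of x n "- y"] by simp

lemma free_on_mult [simp]: "x \<in> free_on n \<Longrightarrow> y \<in> free_on n \<Longrightarrow> x * y \<in> free_on n"
  unfolding free_on_iff using keys_mult[of x y] by (fastforce simp: plus_gword_def)

lemma free_on_sum [simp]: "(\<And>i. i \<in> A \<Longrightarrow> f i \<in> free_on n) \<Longrightarrow> sum f A \<in> free_on n"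
  by (induction A rule: infinite_finite_induct) simp_all

lemma free_on_power [simp]: "x \<in> free_on n \<Longrightarrow> x ^ k \<in> free_on n"
  by (induction k) simp_all

lemma gens_Suc: "gens n \<subseteq> gens (Suc n)"
  by (auto simp: gens_def)

lemma free_on_Suc [simp]: "x \<in> free_on n \<Longrightarrow> x \<in> free_on (Suc n)"
  unfolding free_on_iff using gens_Suc by blast

lemma Framing_in_gens [simp]: "Framing j \<in> gens n \<longleftrightarrow> 1 \<le> j \<and> j \<le> n"
  and Braiding_in_gens [simp]: "Braiding i \<in> gens n \<longleftrightarrow> 1 \<le> i \<and> i < n"
  and Loop_in_gens [simp]: "Loop \<in> gens n"
  by (auto simp: gens_def)

lemma scalar_mult: "scalar (a * b) = scalar a * scalar b"
  by (simp add: scalar_def mult_single)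

lemma scalar_add: "scalar (a + b) = scalar a + scalar b"
  by (simp add: scalar_def single_add)

lemma scalar_uminus: "scalar (- a) = - scalar a"
  by (simp add: scalar_def single_uminus)

lemma scalar_sum: "scalar (sum f A) = (\<Sum>i\<in>A. scalar (f i))"
  by (induction A rule: infinite_finite_induct) (simp_all add: scalar_add)

lemma word_mono_append: "word_mono (v @ w) = word_mono v * word_mono w"
  by (simp add: word_mono_def mult_single plus_gword_def)

lemma word_mono_Nil [simp]: "word_mono [] = 1"
  by (simp add: word_mono_def zero_gword_def[symmetric])

lemma word_mono_Cons: "word_mono (g # w) = gen_el g * word_mono w"
  using word_mono_append[of "[g]" w] by simp

lemma word_mono_replicate: "word_mono (replicate k g) = gen_el g ^ k"
  by (induction k) (simp, simp add: word_mono_Cons[of g "replicate _ g"])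

lemma poly_mapping_eq_sum_singles:
  fixes x :: "'a \<Rightarrow>\<^sub>0 'b::comm_monoid_add"
  shows "x = (\<Sum>w\<in>Poly_Mapping.keys x. Poly_Mapping.single w (Poly_Mapping.lookup x w))"
  by (rule poly_mapping_eqI) (simp add: lookup_sum lookup_single when_def in_keys_iff)

lemma single_word: "Poly_Mapping.single w c = scalar c * word_mono (letters w)"
  by (cases w) (simp add: scalar_def word_mono_def mult_single)

text \<open>The algebra is noncommutative, but a scalar sits at the empty word, which is neutral for
  concatenation on either side; by linearity single words suffice.\<close>

lemma scalar_comm: "scalar c * x = x * scalar c"
proof -
  have 1: "scalar c * Poly_Mapping.single w a = Poly_Mapping.single w a * scalar c" for w a
    by (simp add: scalar_def mult_single mult.commute)
  show ?thesis
    by (subst (1 2) poly_mapping_eq_sum_singles[of x]) (simp add: sum_distrib_left sum_distrib_right 1)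
qed

lemma mult_scalar_left: "x * (scalar c * y) = scalar c * (x * y)"
  by (metis scalar_comm mult.assoc)

text \<open>Words grow at their right end. This fits the spanning argument, where the span is shown
  to be stable under right multiplication by one generator.\<close>

lemma free_on_induct [consumes 1, case_names scalar gen add]:
  assumes x: "x \<in> free_on n"
    and sc: "\<And>c. P (scalar c)"
    and gen: "\<And>x g. x \<in> free_on n \<Longrightarrow> P x \<Longrightarrow> g \<in> gens n \<Longrightarrow> P (x * gen_el g)"
    and add: "\<And>x y. x \<in> free_on n \<Longrightarrow> y \<in> free_on n \<Longrightarrow> P x \<Longrightarrow> P y \<Longrightarrow> P (x + y)"
  shows "P x"
proof -
  have w: "P (scalar c * word_mono w)" if "set w \<subseteq> gens n" for c w
    using that
  proof (induction w rule: rev_induct)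
    case (snoc g w)
    then show ?case
      using gen[of "scalar c * word_mono w" g] by (simp add: word_mono_append mult.assoc)
  qed (use sc in simp)
  have "P (\<Sum>w\<in>A. Poly_Mapping.single w (Poly_Mapping.lookup x w)) \<and>
    (\<Sum>w\<in>A. Poly_Mapping.single w (Poly_Mapping.lookup x w)) \<in> free_on n"
    if "A \<subseteq> Poly_Mapping.keys x" for A
    using finite_subset[OF that finite_keys] that
  proof (induction A rule: finite_induct)
    case empty
    then show ?case using sc[of 0] by simp
  next
    case (insert w A)
    have "set (letters w) \<subseteq> gens n" using insert.prems x by (auto simp: free_on_iff)
    then show ?case
      using insert w by (auto simp: single_word intro!: add)
  qed
  from this[OF order_refl] show ?thesis using poly_mapping_eq_sum_singles[of x] by simp
qed

section \<open>Ring structure of the free algebra and of its quotients\<close>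

lemma free_algebra_simps:
  "x \<otimes>\<^bsub>free_algebra X\<^esub> y = x * y" "\<one>\<^bsub>free_algebra X\<^esub> = 1"
  "x \<oplus>\<^bsub>free_algebra X\<^esub> y = x + y" "\<zero>\<^bsub>free_algebra X\<^esub> = 0"
  "c \<odot>\<^bsub>free_algebra X\<^esub> x = scalar c * x"
  by (simp_all add: free_algebra_def)

lemma ring_free_algebra: "ring (free_algebra (gens n) :: (cuv, free_el) module)"
proof (rule ringI)
  show "abelian_group (free_algebra (gens n) :: (cuv, free_el) module)"
  proof (rule abelian_groupI)
    fix x assume "x \<in> free_on n"
    then show "\<exists>y\<in>free_on n. y \<oplus>\<^bsub>free_algebra (gens n)\<^esub> x = \<zero>\<^bsub>free_algebra (gens n)\<^esub>"
      by (intro bexI[of _ "- x"]) (simp_all add: free_algebra_simps)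
  qed (simp_all add: free_algebra_simps algebra_simps)
  show "Group.monoid (free_algebra (gens n) :: (cuv, free_el) module)"
    by (rule monoidI) (simp_all add: free_algebra_simps algebra_simps)
qed (simp_all add: free_algebra_simps algebra_simps)

lemma quot_algebra_sel:
 "carrier (quot_algebra A I) = carrier (A Quot I)"
  "mult (quot_algebra A I) = mult (A Quot I)" "one (quot_algebra A I) = one (A Quot I)" "zero (quot_algebra A I) = zero (A Quot I)" "add (quot_algebra A I) = add (A Quot I)"
 "smult (quot_algebra A I) = (\<lambda>c X. \<Union>x\<in>X. I +>\<^bsub>A\<^esub> (c \<odot>\<^bsub>A\<^esub> x))"
  by (simp_all add: ring.defs quot_algebra_def module.defs)

text \<open>The operations are those of \<open>A Quot I\<close>, but the record is a different one
  because of its \<open>smult\<close> field, so the ring axioms are carried over one by one.\<close>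

lemma ring_quot_algebra:
  assumes "ideal I A"
  shows "ring (quot_algebra A I)"
proof -
  interpret R: ring "A Quot I" using assms by (rule ideal.quotient_is_ring)
  show ?thesis
  proof (rule ringI)
    show "abelian_group (quot_algebra A I)"
      by (rule abelian_groupI; unfold quot_algebra_sel)
        (simp_all add: R.a_ac R.add.l_inv_ex)
    show "Group.monoid (quot_algebra A I)"
      by (rule monoidI; unfold quot_algebra_sel) (simp_all add: R.m_assoc)
  qed (unfold quot_algebra_sel, simp_all add: R.l_distr R.r_distr)
qed

section \<open>The relation ideal and the congruence modulo it\<close>

lemma idem_e_free_on [simp]: "1 \<le> i \<Longrightarrow> i < n \<Longrightarrow> idem_e d i \<in> free_on n"
  by (simp add: idem_e_def)

lemma idem_f_free_on [simp]: "1 \<le> i \<Longrightarrow> i \<le> n \<Longrightarrow> idem_f d i \<in> free_on n"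
  by (simp add: idem_f_def)

lemma framed_rels_gens:
  assumes "(l, r) \<in> framed_rels d n"
  shows "set l \<subseteq> gens n \<and> set r \<subseteq> gens n"
  using assms
  by cases (auto simp: Transposition.transpose_def)

lemma framed_rels_Suc: "framed_rels d n \<subseteq> framed_rels d (Suc n)"
proof (rule subrelI)
  fix l r assume "(l, r) \<in> framed_rels d n"
  then show "(l, r) \<in> framed_rels d (Suc n)"
    by cases (auto intro: framed_rels.intros simp del: One_nat_def)
qed

lemma yokonuma_rels_free_on:
  assumes "n \<ge> 1" "(l, r) \<in> yokonuma_rels d n"
  shows "l \<in> free_on n" "r \<in> free_on n"
  using assms(2,1) framed_rels_gens by (auto simp: yokonuma_rels_def dest!: framed_rels_gens)

lemma yokonuma_rels_Suc: "yokonuma_rels d n \<subseteq> yokonuma_rels d (Suc n)"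
  unfolding yokonuma_rels_def using framed_rels_Suc[of d n] by auto

text \<open>Rank and membership are part of the relation, so the rules for transitivity, sums and
  products carry no side conditions. Rank 0 is excluded because the quadratic relation of the loop
  contains \<open>idem_f d 1\<close>, and t_1 is not a generator there.\<close>

definition cong :: "nat \<Rightarrow> nat \<Rightarrow> free_el \<Rightarrow> free_el \<Rightarrow> bool" where
  "cong d n x y \<longleftrightarrow> 1 \<le> n \<and> x \<in> free_on n \<and> y \<in> free_on n \<and> x - y \<in> yokonuma_ideal d n"

locale framing_modulus =
  fixes d :: nat
  assumes d_pos: "1 \<le> d"
begin

abbreviation cong_n ("(_/ \<approx>[_] _)" [51,0,51] 50) where "x \<approx>[n] y \<equiv> cong d n x y"

lemma yokonuma_ideal_ideal:
  assumes "n \<ge> 1"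
  shows "ideal (yokonuma_ideal d n) (free_algebra (gens n))"
  unfolding yokonuma_ideal_def relation_ideal_def
  by (rule ring.genideal_ideal[OF ring_free_algebra])
    (use yokonuma_rels_free_on[OF assms] in auto)

context
  fixes n :: nat
  assumes n: "n \<ge> 1"
begin

interpretation I: ideal "yokonuma_ideal d n" "free_algebra (gens n)"
  by (rule yokonuma_ideal_ideal[OF n])

lemma ideal_lower_part: "x \<in> yokonuma_ideal d n \<Longrightarrow> x \<in> free_on n"
  by (rule I.a_Hcarr)

lemma ideal_0: "0 \<in> yokonuma_ideal d n"
  using additive_subgroup.zero_closed[OF I.is_additive_subgroup] by (simp only: free_algebra_simps)

lemma ideal_add: "x \<in> yokonuma_ideal d n \<Longrightarrow> y \<in> yokonuma_ideal d n \<Longrightarrow> x + y \<in> yokonuma_ideal d n"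
  using additive_subgroup.a_closed[OF I.is_additive_subgroup, of x y] by (simp only: free_algebra_simps)

lemma ideal_l: "x \<in> yokonuma_ideal d n \<Longrightarrow> y \<in> free_on n \<Longrightarrow> y * x \<in> yokonuma_ideal d n"
  using I.I_l_closed[of x y] by (simp only: free_algebra_simps)

lemma ideal_r: "x \<in> yokonuma_ideal d n \<Longrightarrow> y \<in> free_on n \<Longrightarrow> x * y \<in> yokonuma_ideal d n"
  using I.I_r_closed[of x y] by (simp only: free_algebra_simps)

lemma ideal_minus: "x \<in> yokonuma_ideal d n \<Longrightarrow> - x \<in> yokonuma_ideal d n"
  using ideal_l[of x "- 1"] by simp

lemma ideal_rel: "(l, r) \<in> yokonuma_rels d n \<Longrightarrow> l - r \<in> yokonuma_ideal d n"
  unfolding yokonuma_ideal_def relation_ideal_def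
  using ring.genideal_self[OF ring_free_algebra, of "{l - r | l r. (l, r) \<in> yokonuma_rels d n}" n]
    yokonuma_rels_free_on[OF n] by fastforce

end

text \<open>The part of the larger ideal lying in the smaller free algebra is an ideal there and
  contains the relations of rank n, so minimality of the generated ideal applies. This makes the
  passage from n to n + 1 strands well defined.\<close>

lemma ideal_Suc:
  assumes "n \<ge> 1" "x \<in> yokonuma_ideal d n"
  shows "x \<in> yokonuma_ideal d (Suc n)"
proof -
  let ?J = "yokonuma_ideal d (Suc n) \<inter> free_on n"
  have n': "Suc n \<ge> 1" by simp
  have "ideal ?J (free_algebra (gens n))"
  proof (rule idealI[OF ring_free_algebra])
    show "subgroup ?J (add_monoid (free_algebra (gens n)))"
    proof (rule group.subgroupI)
      show "Group.group (add_monoid (free_algebra (gens n) :: (cuv, free_el) module))"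
        using ring_free_algebra[of n]
        by (simp add: ring_def abelian_group.a_group)
      fix a assume a: "a \<in> ?J"
      have "inv\<^bsub>add_monoid (free_algebra (gens n))\<^esub> a = - a"
        using a ring.ring_simprules(3)[OF ring_free_algebra]
        by (intro abelian_group.minus_equality[OF ring.is_abelian_group[OF ring_free_algebra], unfolded a_inv_def])
          (auto simp: free_algebra_simps)
      then show "inv\<^bsub>add_monoid (free_algebra (gens n))\<^esub> a \<in> ?J"
        using a ideal_minus[OF n'] by auto
    qed (use ideal_0[OF n'] ideal_add[OF n'] in \<open>auto simp: free_algebra_simps\<close>)
  qed (use ideal_l[OF n'] ideal_r[OF n'] in \<open>auto simp: free_algebra_simps\<close>)
  moreover have "{l - r |l r. (l, r) \<in> yokonuma_rels d n} \<subseteq> ?J"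
    using yokonuma_rels_Suc ideal_rel[OF n'] yokonuma_rels_free_on[OF assms(1)] by fastforce
  ultimately have "yokonuma_ideal d n \<subseteq> ?J"
    unfolding yokonuma_ideal_def relation_ideal_def
    by (rule ring.genideal_minimal[OF ring_free_algebra])
  then show ?thesis using assms by blast
qed

lemma cong_refl: "x \<in> free_on n \<Longrightarrow> 1 \<le> n \<Longrightarrow> x \<approx>[n] x"
  by (simp add: cong_def ideal_0)

lemma cong_sym: "x \<approx>[n] y \<Longrightarrow> y \<approx>[n] x"
  using ideal_minus[of n "x - y"] by (auto simp: cong_def)

lemma cong_trans [trans]: "x \<approx>[n] y \<Longrightarrow> y \<approx>[n] z \<Longrightarrow> x \<approx>[n] z"
  using ideal_add[of n "x - y" "y - z"] by (auto simp: cong_def)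

lemma cong_add: "x \<approx>[n] x' \<Longrightarrow> y \<approx>[n] y' \<Longrightarrow> x + y \<approx>[n] x' + y'"
  using ideal_add[of n "x - x'" "y - y'"] by (auto simp: cong_def algebra_simps)

lemma cong_minus: "x \<approx>[n] y \<Longrightarrow> - x \<approx>[n] - y"
  using ideal_minus[of n "x - y"] by (auto simp: cong_def)

lemma cong_diff: "x \<approx>[n] x' \<Longrightarrow> y \<approx>[n] y' \<Longrightarrow> x - y \<approx>[n] x' - y'"
  using cong_add[OF _ cong_minus, of n x x' y y'] by simp

lemma cong_mult: "x \<approx>[n] x' \<Longrightarrow> y \<approx>[n] y' \<Longrightarrow> x * y \<approx>[n] x' * y'"
  using ideal_add[of n "(x - x') * y" "x' * (y - y')"] ideal_l[of n "y - y'" x'] ideal_r[of n "x - x'" y]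
  by (auto simp: cong_def algebra_simps)

lemma cong_free_on1: "x \<approx>[n] y \<Longrightarrow> x \<in> free_on n" and cong_free_on2: "x \<approx>[n] y \<Longrightarrow> y \<in> free_on n"
  and cong_ge1: "x \<approx>[n] y \<Longrightarrow> 1 \<le> n"
  by (simp_all add: cong_def)

lemma cong_mult_left: "y \<approx>[n] y' \<Longrightarrow> a \<in> free_on n \<Longrightarrow> a * y \<approx>[n] a * y'"
  by (intro cong_mult cong_refl) (simp_all add: cong_def)

lemma cong_mult_right: "x \<approx>[n] x' \<Longrightarrow> a \<in> free_on n \<Longrightarrow> x * a \<approx>[n] x' * a"
  by (intro cong_mult cong_refl) (simp_all add: cong_def)

lemma cong_ctx: "x \<approx>[n] y \<Longrightarrow> a \<in> free_on n \<Longrightarrow> b \<in> free_on n \<Longrightarrow> a * x * b \<approx>[n] a * y * b"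
  by (intro cong_mult_left cong_mult_right)

lemma cong_power: "x \<approx>[n] y \<Longrightarrow> x ^ k \<approx>[n] y ^ k"
  by (induction k) (auto intro: cong_mult cong_refl dest: cong_ge1)

lemma cong_sum: "1 \<le> n \<Longrightarrow> (\<And>i. i \<in> A \<Longrightarrow> f i \<approx>[n] g i) \<Longrightarrow> sum f A \<approx>[n] sum g A"
  by (induction A rule: infinite_finite_induct) (simp_all add: cong_add cong_refl)

lemma cong_Suc: "x \<approx>[n] y \<Longrightarrow> x \<approx>[Suc n] y"
  by (simp add: cong_def ideal_Suc)

lemma free_on_mono: "m \<le> n \<Longrightarrow> x \<in> free_on m \<Longrightarrow> x \<in> free_on n"
  by (induction n rule: dec_induct) simp_all

text \<open>A congruence between x g and g y says that x crosses g and comes out as y. Such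
  crossings compose along products of the g's, here, and along products of the x's in
  \<open>intertwine_prod\<close>; most commutation arguments are chains of them.\<close>

lemma intertwine_mult: "x * g \<approx>[n] g * y \<Longrightarrow> y * h \<approx>[n] h * z \<Longrightarrow> g \<in> free_on n \<Longrightarrow> h \<in> free_on n \<Longrightarrow>
    x * (g * h) \<approx>[n] (g * h) * z"
  using cong_mult_right[of n "x * g" "g * y" h] cong_mult_left[of n "y * h" "h * z" g]
  by (auto simp: mult.assoc intro: cong_trans)

lemma intertwine_prod: "x * g \<approx>[n] g * y \<Longrightarrow> x' * g \<approx>[n] g * y' \<Longrightarrow> x \<in> free_on n \<Longrightarrow> y' \<in> free_on n \<Longrightarrow>
    (x * x') * g \<approx>[n] g * (y * y')"
  using cong_mult_left[of n "x' * g" "g * y'" x] cong_mult_right[of n "x * g" "g * y" y']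
  by (auto simp: mult.assoc intro: cong_trans)

lemma intertwine_power: "x * g \<approx>[n] g * y \<Longrightarrow> x \<in> free_on n \<Longrightarrow> y \<in> free_on n \<Longrightarrow> g \<in> free_on n \<Longrightarrow> x ^ k * g \<approx>[n] g * y ^ k"
proof (induction k)
  case 0
  then show ?case using cong_refl[OF _ cong_ge1] by simp
next
  case (Suc k)
  then show ?case using intertwine_prod[of n x g y "x ^ k" "y ^ k"] by simp
qed

lemma intertwine_add: "x * g \<approx>[n] g * y \<Longrightarrow> x' * g \<approx>[n] g * y' \<Longrightarrow> (x + x') * g \<approx>[n] g * (y + y')"
  using cong_add by (fastforce simp: algebra_simps)

lemma intertwine_sum: "1 \<le> n \<Longrightarrow> (\<And>i. i \<in> A \<Longrightarrow> x i * g \<approx>[n] g * y i) \<Longrightarrow> sum x A * g \<approx>[n] g * sum y A"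
  by (simp add: sum_distrib_left sum_distrib_right cong_sum)

lemma intertwine_scalar_mult: "x * g \<approx>[n] g * y \<Longrightarrow> scalar c * x * g \<approx>[n] g * (scalar c * y)"
  using cong_mult_left[of n "x * g" "g * y" "scalar c"] by (simp add: mult_scalar_left mult.assoc)

section \<open>The defining relations as congruences\<close>

lemma rel_word: "(l, r) \<in> framed_rels d n \<Longrightarrow> 1 \<le> n \<Longrightarrow> word_mono l \<approx>[n] word_mono r"
  using ideal_rel[of n "word_mono l" "word_mono r"] framed_rels_gens[of l r d n]
  by (auto simp: cong_def yokonuma_rels_def)

lemma g_far:
  assumes "i \<in> {1..<n}" "j \<in> {1..<n}" "i + 1 < j \<or> j + 1 < i"
  shows "fg i * fg j \<approx>[n] fg j * fg i"
  using rel_word[OF framed_rels.far[OF assms]] assms by (simp add: word_mono_Cons[of _ "[_]"])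

lemma g_braid:
  assumes "i \<in> {1..<n}" "j \<in> {1..<n}" "i + 1 = j \<or> j + 1 = i"
  shows "fg i * (fg j * fg i) \<approx>[n] fg j * (fg i * fg j)"
  using rel_word[OF framed_rels.braid[OF assms]] assms
  by (simp add: word_mono_Cons[of _ "_ # _"])

lemma b_far:
  assumes "i \<in> {1..<n}" "i > 1"
  shows "fb * fg i \<approx>[n] fg i * fb"
  using rel_word[OF framed_rels.loop_far[OF assms]] assms by (simp add: word_mono_Cons[of _ "_ # _"])

lemma b_braid:
  assumes "1 < n"
  shows "fb * (fg 1 * (fb * fg 1)) \<approx>[n] fg 1 * (fb * (fg 1 * fb))"
  using rel_word[OF framed_rels.loop_braid, of n] assms by (simp add: word_mono_Cons[of _ "_ # _"])

lemma t_comm: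
  assumes "i \<in> {1..n}" "j \<in> {1..n}"
  shows "ft i * ft j \<approx>[n] ft j * ft i"
  using rel_word[OF framed_rels.framing_comm[OF assms]] assms by (simp add: word_mono_Cons[of _ "_ # _"])

lemma t_order:
  assumes "i \<in> {1..n}"
  shows "ft i ^ d \<approx>[n] 1"
  using rel_word[OF framed_rels.framing_order[OF assms]] assms by (simp add: word_mono_replicate)

lemma t_g:
  assumes "i \<in> {1..<n}" "j \<in> {1..n}"
  shows "ft j * fg i \<approx>[n] fg i * ft (Transposition.transpose i (i + 1) j)"
  using rel_word[OF framed_rels.framing_braid[OF assms]] assms by (simp add: word_mono_Cons[of _ "_ # _"])

lemma t_g_same: "i \<in> {1..<n} \<Longrightarrow> ft i * fg i \<approx>[n] fg i * ft (Suc i)"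
  and t_g_Suc: "i \<in> {1..<n} \<Longrightarrow> ft (Suc i) * fg i \<approx>[n] fg i * ft i"
  and t_g_far: "i \<in> {1..<n} \<Longrightarrow> j \<in> {1..n} \<Longrightarrow> j \<noteq> i \<Longrightarrow> j \<noteq> Suc i \<Longrightarrow> ft j * fg i \<approx>[n] fg i * ft j"
  using t_g[of i n i] t_g[of i n "Suc i"] t_g[of i n j] by (auto simp: Transposition.transpose_def)

lemma t_b:
  assumes "i \<in> {1..n}"
  shows "ft i * fb \<approx>[n] fb * ft i"
  using rel_word[OF framed_rels.framing_loop[OF assms]] assms by (simp add: word_mono_Cons[of _ "_ # _"])

lemma g_square:
  assumes "i \<in> {1..<n}"
  shows "fg i * fg i \<approx>[n] 1 + scalar (ind_u - inverse ind_u) * idem_e d i * fg i"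
  using ideal_rel[of n "fg i ^ 2" "1 + scalar (ind_u - inverse ind_u) * idem_e d i * fg i"] assms
  by (auto simp: cong_def yokonuma_rels_def power2_eq_square)

lemma b_square:
  assumes "1 \<le> n"
  shows "fb * fb \<approx>[n] 1 + scalar (ind_v - inverse ind_v) * idem_f d 1 * fb"
  using ideal_rel[of n "fb ^ 2" "1 + scalar (ind_v - inverse ind_v) * idem_f d 1 * fb"] assms
  by (auto simp: cong_def yokonuma_rels_def power2_eq_square)

text \<open>The elements commuting with a form a subalgebra, so generators suffice. Two ranks occur
  since a involves strands beyond those of x.\<close>

lemma comm_free_on:
  assumes a: "a \<in> free_on N" and nN: "n \<le> N" "1 \<le> N"
    and g: "\<And>g. g \<in> gens n \<Longrightarrow> gen_el g * a \<approx>[N] a * gen_el g"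
    and x: "x \<in> free_on n"
  shows "x * a \<approx>[N] a * x"
  using x
proof (induction rule: free_on_induct)
  case (scalar c)
  then show ?case using a nN cong_refl[of "a * scalar c" N] by (simp add: scalar_comm)
next
  case (gen x h)
  then have "gen_el h \<in> free_on N" "x \<in> free_on N" using free_on_mono[OF nN(1)] by simp_all
  then show ?case using gen g a by (intro intertwine_prod) simp_all
qed (rule intertwine_add)

end

section \<open>The spanning set\<close>

context framing_modulus
begin

text \<open>The coefficients allowed in rank \<open>n + 1\<close>. For \<open>n = 0\<close> they are the scalars only, although
  \<open>gens 0\<close> still contains the loop.\<close>

definition lower_part :: "nat \<Rightarrow> free_el set" where
  "lower_part n = (if n = 0 then range scalar else free_on n)"

lemma lower_part_scalar [simp]: "scalar c \<in> lower_part n" by (simp add: lower_part_def)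
lemma lower_part_1 [simp]: "1 \<in> lower_part n" using lower_part_scalar[of 1] by simp
lemma lower_part_mult [simp]: "x \<in> lower_part n \<Longrightarrow> y \<in> lower_part n \<Longrightarrow> x * y \<in> lower_part n"
  by (auto simp: lower_part_def simp flip: scalar_mult)
lemma lower_part_free_on: "x \<in> lower_part n \<Longrightarrow> n \<le> m \<Longrightarrow> x \<in> free_on m"
  by (auto simp: lower_part_def split: if_splits intro: free_on_mono)
lemma lower_part_pos: "1 \<le> n \<Longrightarrow> lower_part n = free_on n" by (simp add: lower_part_def)

lemma comm_lower_part:
  assumes a: "a \<in> free_on N" and nN: "n \<le> N" "1 \<le> N"
    and g: "\<And>g. 1 \<le> n \<Longrightarrow> g \<in> gens n \<Longrightarrow> gen_el g * a \<approx>[N] a * gen_el g"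
    and x: "x \<in> lower_part n"
  shows "x * a \<approx>[N] a * x"
proof (cases "n = 0")
  case True
  with x obtain c where "x = scalar c" by (auto simp: lower_part_def)
  then show ?thesis using a nN cong_refl[of "a * scalar c" N] by (simp add: scalar_comm)
next
  case False
  then show ?thesis using comm_free_on[OF a nN g] x by (simp add: lower_part_def)
qed

section \<open>Spanning elements of rank n + 1 and their closure properties\<close>

lemma gens_cases:
  assumes "g \<in> gens n"
  obtains j where "g = Framing j" "j \<in> {1..n}" | i where "g = Braiding i" "i \<in> {1..<n}" | "g = Loop"
  using assms by (auto simp: gens_def)

text \<open>Strand n + 1 is fixed by the transpositions belonging to all g_i with i < n.\<close>

lemma lower_part_comm_t:
  assumes "x \<in> lower_part n"
  shows "x * ft (Suc n) ^ k \<approx>[Suc n] ft (Suc n) ^ k * x"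
proof (rule comm_lower_part[OF _ _ _ _ assms])
  fix g assume "g \<in> gens n"
  then have "ft (Suc n) * gen_el g \<approx>[Suc n] gen_el g * ft (Suc n)"
    by (cases g rule: gens_cases) (auto intro!: t_comm t_b t_g_far)
  from intertwine_power[OF this, of k] \<open>g \<in> gens n\<close>
  show "gen_el g * ft (Suc n) ^ k \<approx>[Suc n] ft (Suc n) ^ k * gen_el g"
    using gens_Suc by (auto intro: cong_sym)
qed simp_all

text \<open>g_(m+1) moves only the strands m + 1 and m + 2. For m = 0 no relation lets the loop
  commute with g_1; this is why \<open>lower_part 0\<close> consists of scalars only.\<close>

lemma lower_part_comm_g:
  assumes "x \<in> lower_part m"
  shows "x * fg (Suc m) \<approx>[Suc (Suc m)] fg (Suc m) * x"
proof (rule comm_lower_part[OF _ _ _ _ assms])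
  fix g assume "g \<in> gens m" "1 \<le> m"
  then show "gen_el g * fg (Suc m) \<approx>[Suc (Suc m)] fg (Suc m) * gen_el g"
    by (cases g rule: gens_cases) (auto intro!: t_g_far b_far g_far)
qed simp_all

text \<open>Given by closure rules instead of explicit linear combinations, so that an additive
  property invariant under the congruence can be proved by induction over it. The element c is a
  parameter because two choices occur: \<open>murphy n\<close>, for which stability under
  multiplication can be shown, and \<open>loop_rep n\<close>, on which the trace is prescribed.
  Scalars belong to \<open>lower_part n\<close> and need no rule of their own; rank 0 has no third
  kind, there being no g_0.\<close>

inductive rank_span :: "nat \<Rightarrow> free_el \<Rightarrow> free_el \<Rightarrow> bool" for n c where
  frame: "a \<in> lower_part n \<Longrightarrow> rank_span n c (a * ft (Suc n) ^ k)"
| loop: "a \<in> lower_part n \<Longrightarrow> rank_span n c (a * c * ft (Suc n) ^ k)"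
| braid: "1 \<le> n \<Longrightarrow> a \<in> free_on n \<Longrightarrow> b \<in> free_on n \<Longrightarrow> rank_span n c (a * fg n * b)"
| add: "rank_span n c x \<Longrightarrow> rank_span n c y \<Longrightarrow> rank_span n c (x + y)"
| equiv: "rank_span n c x \<Longrightarrow> x \<approx>[Suc n] y \<Longrightarrow> rank_span n c y"

lemma rank_span_free_on: "rank_span n c x \<Longrightarrow> c \<in> free_on (Suc n) \<Longrightarrow> x \<in> free_on (Suc n)"
  by (induction rule: rank_span.induct) (auto dest: lower_part_free_on[of _ _ "Suc n"] cong_free_on2)

lemma rank_span_left:
  assumes "rank_span n c x" "a \<in> lower_part n"
  shows "rank_span n c (a * x)"
  using assms(1)
proof (induction rule: rank_span.induct)
  case (frame a' k)
  then show ?case using rank_span.frame[of "a * a'" n c k] assms(2) by (simp add: mult.assoc)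
next
  case (loop a' k)
  then show ?case using rank_span.loop[of "a * a'" n c k] assms(2) by (simp add: mult.assoc)
next
  case (braid a' b)
  then show ?case using rank_span.braid[of n "a * a'" b c] assms(2) by (simp add: mult.assoc lower_part_pos)
next
  case (add x y)
  then show ?case using rank_span.add by (simp add: distrib_left)
next
  case (equiv x y)
  then show ?case using rank_span.equiv cong_mult_left lower_part_free_on[OF assms(2), of "Suc n"] by simp
qed

lemma rank_span_scalar: "rank_span n c x \<Longrightarrow> rank_span n c (scalar s * x)"
  by (simp add: rank_span_left)

lemma rank_span_0: "rank_span n c 0"
  using rank_span.frame[of 0 n c 0] lower_part_scalar[of 0] by simp

lemma rank_span_sum: "(\<And>i. i \<in> A \<Longrightarrow> rank_span n c (f i)) \<Longrightarrow> rank_span n c (sum f A)"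
  by (induction A rule: infinite_finite_induct) (simp_all add: rank_span_0 rank_span.add)

text \<open>The quadratic relations insert e_n between two factors; expanding it leaves monomials in
  t_n and t_(n+1).\<close>

lemma rank_span_idem_e:
  assumes "\<And>s r. rank_span n c (a * (ft n ^ s * ft (Suc n) ^ r) * b)"
  shows "rank_span n c (a * (scalar q * idem_e d n) * b)"
proof -
  have "a * (scalar q * idem_e d n) * b =
      scalar q * (scalar (1 / of_nat d) * (\<Sum>s<d. a * (ft n ^ s * ft (Suc n) ^ (d - s)) * b))"
    by (simp add: idem_e_def mult_scalar_left[of a] mult.assoc sum_distrib_left sum_distrib_right)
  then show ?thesis using assms by (simp add: rank_span_scalar rank_span_sum)
qed

text \<open>In a g_n b the power commutes with b and crosses g_n from right to left as t_n^k, which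
  joins the left coefficient.\<close>

lemma rank_span_right_t:
  assumes "rank_span n c x"
  shows "rank_span n c (x * ft (Suc n) ^ k)"
  using assms
proof (induction rule: rank_span.induct)
  case (frame a' l)
  then show ?case using rank_span.frame[of a' n c "l + k"] by (simp add: mult.assoc power_add)
next
  case (loop a' l)
  then show ?case using rank_span.loop[of a' n c "l + k"] by (simp add: mult.assoc power_add)
next
  case (braid a b)
  then have b: "b * ft (Suc n) ^ k \<approx>[Suc n] ft (Suc n) ^ k * b"
    by (intro lower_part_comm_t) (simp add: lower_part_pos)
  have t: "ft n ^ k * fg n \<approx>[Suc n] fg n * ft (Suc n) ^ k"
    using braid by (intro intertwine_power t_g_same) auto
  have "(a * ft n ^ k) * fg n * b = a * (ft n ^ k * fg n) * b" by (simp add: mult.assoc)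
  also have "\<dots> \<approx>[Suc n] a * (fg n * ft (Suc n) ^ k) * b"
    using braid by (intro cong_ctx t) simp_all
  also have "\<dots> = a * fg n * (ft (Suc n) ^ k * b)" by (simp add: mult.assoc)
  also have "\<dots> \<approx>[Suc n] a * fg n * (b * ft (Suc n) ^ k)"
    using braid by (intro cong_mult_left cong_sym[OF b]) simp_all
  also have "\<dots> = a * fg n * b * ft (Suc n) ^ k" by (simp add: mult.assoc)
  finally show ?case
    using rank_span.equiv[OF rank_span.braid[of n "a * ft n ^ k" b c]] braid by simp
next
  case (add x y)
  then show ?case using rank_span.add by (simp add: distrib_right)
next
  case (equiv x y)
  then show ?case using rank_span.equiv cong_mult_right[of "Suc n" x y] by simp
qed

text \<open>As c occurs in the span only in the form a c t_(n+1)^k, closure under left coefficients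
  and right powers of t_(n+1) is all that is asked of the span for c'.\<close>

lemma rank_span_subst:
  assumes "rank_span n c' c" "rank_span n c x"
  shows "rank_span n c' x"
  using assms(2)
proof (induction rule: rank_span.induct)
  case (loop a k)
  then show ?case using rank_span_right_t rank_span_left assms(1) by blast
qed (auto intro: rank_span.intros)

text \<open>In e_n g_n every monomial satisfies t_n^s t_(n+1)^r g_n = t_n^s g_n t_n^r, which is of
  the third kind.\<close>

lemma rank_span_g_square: "1 \<le> n \<Longrightarrow> rank_span n c (fg n * fg n)"
proof -
  assume n: "1 \<le> n"
  have "rank_span n c (1 * (ft n ^ s * ft (Suc n) ^ r) * fg n)" for s r
  proof (rule rank_span.equiv[OF rank_span.braid[of n "ft n ^ s" "ft n ^ r"]])
    have "ft (Suc n) ^ r * fg n \<approx>[Suc n] fg n * ft n ^ r"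
      using n by (intro intertwine_power t_g_Suc) auto
    from cong_mult_left[OF cong_sym[OF this], of "ft n ^ s"]
    show "ft n ^ s * fg n * ft n ^ r \<approx>[Suc n] 1 * (ft n ^ s * ft (Suc n) ^ r) * fg n"
      using n by (simp add: mult.assoc)
  qed (use n in auto)
  then have "rank_span n c (1 + scalar (ind_u - inverse ind_u) * idem_e d n * fg n)"
    using rank_span.frame[of 1 n c 0] rank_span_idem_e[of n c 1] by (intro rank_span.add) simp_all
  then show ?thesis
    by (rule rank_span.equiv[OF _ cong_sym[OF g_square]]) (use n in auto)
qed

text \<open>The core of the rewriting: two letters g_(m+1) with an element on m + 1 strands between
  them. Lower coefficients and framings move outwards; what stays between the letters is 1, c or
  g_m, settled by the quadratic relation, by assumption and by the braid relation
  respectively.\<close>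

lemma rank_span_sandwich:
  assumes c: "c \<in> free_on (Suc m)"
    and c': "rank_span (Suc m) c' (fg (Suc m) * c * fg (Suc m))"
    and x: "rank_span m c x"
  shows "rank_span (Suc m) c' (fg (Suc m) * x * fg (Suc m))"
  using x
proof (induction rule: rank_span.induct)
  let ?n = "Suc m" and ?N = "Suc (Suc m)" and ?g = "fg (Suc m)"
  have t: "ft ?n ^ k * ?g \<approx>[?N] ?g * ft ?N ^ k" for k
    by (intro intertwine_power t_g_same) auto
  \<comment> \<open>Common treatment of the first two kinds, with y = 1 and y = c: a commutes with
    g_(m+1), and t_(m+1)^k crosses it as t_(m+2)^k.\<close>
  have main: "rank_span ?n c' (?g * (a * y * ft ?n ^ k) * ?g)"
    if a: "a \<in> lower_part m" and y: "y \<in> free_on ?N" "rank_span ?n c' (?g * y * ?g)" for a y k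
  proof (rule rank_span.equiv)
    have aF: "a \<in> free_on ?n" "a \<in> free_on ?N" using a lower_part_free_on by auto
    show "rank_span ?n c' (a * (?g * y * ?g) * ft ?N ^ k)"
      using aF by (intro rank_span_right_t rank_span_left[OF y(2)]) (simp add: lower_part_pos)
    have "a * (?g * y * ?g) * ft ?N ^ k = (a * ?g) * (y * (?g * ft ?N ^ k))" by (simp add: mult.assoc)
    also have "\<dots> \<approx>[?N] (?g * a) * (y * (ft ?n ^ k * ?g))"
      using y by (intro cong_mult cong_refl lower_part_comm_g a cong_sym[OF t]) simp_all
    finally show "a * (?g * y * ?g) * ft ?N ^ k \<approx>[?N] ?g * (a * y * ft ?n ^ k) * ?g"
      by (simp add: mult.assoc)
  qed
  { case (frame a k)
    then show ?case using main[of a 1 k] rank_span_g_square[of ?n c'] by simp }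
  { case (loop a k)
    then show ?case using main[of a c k] c c' by simp }
  { case (braid a b)
    have a: "a * ?g \<approx>[?N] ?g * a" and b: "b * ?g \<approx>[?N] ?g * b"
      using braid by (auto intro!: lower_part_comm_g simp: lower_part_pos)
    have F: "a \<in> free_on ?N" "b \<in> free_on ?N" using braid by auto
    have "(a * fg m) * ?g * (fg m * b) = a * (fg m * (?g * fg m)) * b" by (simp add: mult.assoc)
    also have "\<dots> \<approx>[?N] a * (?g * (fg m * ?g)) * b"
      using braid F by (intro cong_ctx g_braid) auto
    also have "\<dots> = (a * ?g) * (fg m * (?g * b))" by (simp add: mult.assoc)
    also have "\<dots> \<approx>[?N] (?g * a) * (fg m * (b * ?g))"
      using braid F by (intro cong_mult[OF a] cong_mult_left cong_sym[OF b]) auto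
    finally show ?case
      using rank_span.equiv[OF rank_span.braid[of ?n "a * fg m" "fg m * b" c']] braid by (simp add: mult.assoc) }
  { case (add x y)
    then show ?case using rank_span.add by (simp add: distrib_left distrib_right) }
  { case (equiv x y)
    then show ?case using rank_span.equiv[OF _ cong_ctx[OF cong_Suc[OF equiv(2)], of ?g ?g]] by simp }
qed

text \<open>Unlike the elements \<open>b\<^sub>n\<^sub>+\<^sub>1\<close> of the trace rules, these Jucys-Murphy type elements commute with
  all generators of the lower algebra; \<open>murphy k\<close> lives on \<open>k + 1\<close> strands.\<close>

fun murphy :: "nat \<Rightarrow> free_el" where
  "murphy 0 = fb"
| "murphy (Suc k) = fg (Suc k) * murphy k * fg (Suc k)"

section \<open>Commutation of the Jucys-Murphy type elements\<close>

lemma murphy_free_on: "k < n \<Longrightarrow> murphy k \<in> free_on n"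
  by (induction k) simp_all

text \<open>t_j crosses the first g_(k+1) with its index transposed, passes the inner element by
  induction, and gets its index back at the second g_(k+1).\<close>

lemma murphy_t: "k < n \<Longrightarrow> j \<in> {1..n} \<Longrightarrow> ft j * murphy k \<approx>[n] murphy k * ft j"
proof (induction k arbitrary: j)
  case 0
  then show ?case by (simp add: t_b)
next
  case (Suc k)
  define j' where "j' = Transposition.transpose (Suc k) (Suc (Suc k)) j"
  have j': "j' \<in> {1..n}" "Transposition.transpose (Suc k) (Suc (Suc k)) j' = j"
    using Suc.prems by (auto simp: j'_def Transposition.transpose_def)
  have 1: "ft j * fg (Suc k) \<approx>[n] fg (Suc k) * ft j'"
    using t_g[of "Suc k" n j] Suc.prems by (simp add: j'_def)
  have 2: "ft j' * fg (Suc k) \<approx>[n] fg (Suc k) * ft j"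
    using t_g[of "Suc k" n j'] Suc.prems j' by simp
  have "ft j' * murphy k \<approx>[n] murphy k * ft j'" using Suc j' by simp
  from intertwine_mult[OF intertwine_mult[OF 1 this] 2] show ?case using Suc.prems murphy_free_on[of k n] by simp
qed

lemma murphy_g_above: "k < n \<Longrightarrow> Suc k < i \<Longrightarrow> i < n \<Longrightarrow> fg i * murphy k \<approx>[n] murphy k * fg i"
proof (induction k)
  case 0
  then show ?case using b_far[of i n] by (auto intro: cong_sym)
next
  case (Suc k)
  have 1: "fg i * fg (Suc k) \<approx>[n] fg (Suc k) * fg i" using Suc.prems by (intro g_far) auto
  have "fg i * murphy k \<approx>[n] murphy k * fg i" using Suc by simp
  from intertwine_mult[OF intertwine_mult[OF 1 this] 1] show ?case using Suc.prems murphy_free_on[of k n] by simp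
qed

text \<open>For i = k, in the step to k + 1, two layers must be opened: crossing g_(k+1) g_k turns
  g_k into g_(k+1), which is far from the inner element, and crossing g_k g_(k+1) turns it
  back.\<close>

lemma murphy_g_below: "k < n \<Longrightarrow> 1 \<le> i \<Longrightarrow> i < k \<Longrightarrow> fg i * murphy k \<approx>[n] murphy k * fg i"
proof (induction k)
  case (Suc k)
  show ?case
  proof (cases "i = k")
    case True
    then obtain l where k: "k = Suc l" using Suc.prems by (cases k) auto
    have J: "murphy l \<in> free_on n" using Suc.prems k by (intro murphy_free_on) auto
    have 1: "fg k * (fg (Suc k) * fg k) \<approx>[n] (fg (Suc k) * fg k) * fg (Suc k)"
      "fg (Suc k) * (fg k * fg (Suc k)) \<approx>[n] (fg k * fg (Suc k)) * fg k"
      using g_braid[of k n "Suc k"] g_braid[of "Suc k" n k] Suc.prems k by (simp_all add: mult.assoc)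
    have "fg (Suc k) * murphy l \<approx>[n] murphy l * fg (Suc k)"
      using Suc.prems k by (intro murphy_g_above) auto
    from intertwine_mult[OF intertwine_mult[OF 1(1) this] 1(2)] show ?thesis
      using Suc.prems J True by (simp add: k mult.assoc)
  next
    case False
    have 1: "fg i * fg (Suc k) \<approx>[n] fg (Suc k) * fg i" using Suc.prems False by (intro g_far) auto
    have "fg i * murphy k \<approx>[n] murphy k * fg i" using Suc False by simp
    from intertwine_mult[OF intertwine_mult[OF 1 this] 1] show ?thesis using Suc.prems murphy_free_on[of k n] by simp
  qed
qed simp

text \<open>For k = 1 this is exactly the four-term loop relation, and it is the reason for taking g
  on both sides: b_2 ends in g_1^(-1) instead, and the relation does not say that b_1 commutes with
  it. For larger k the loop is far from the outer letters.\<close>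

lemma murphy_b: "k < n \<Longrightarrow> fb * murphy k \<approx>[n] murphy k * fb"
proof (induction k)
  case 0
  then show ?case by (simp add: cong_refl)
next
  case (Suc k)
  show ?case
  proof (cases "k = 0")
    case True
    then show ?thesis using b_braid[of n] Suc.prems by (simp add: mult.assoc)
  next
    case False
    then have 1: "fb * fg (Suc k) \<approx>[n] fg (Suc k) * fb"
      using b_far[of "Suc k" n] Suc.prems by simp
    have "fb * murphy k \<approx>[n] murphy k * fb" using Suc by simp
    from intertwine_mult[OF intertwine_mult[OF 1 this] 1] show ?thesis using Suc.prems murphy_free_on[of k n] by simp
  qed
qed

lemma murphy_comm:
  assumes "1 \<le> n" "x \<in> free_on n"
  shows "x * murphy n \<approx>[Suc n] murphy n * x"
proof (rule comm_free_on[OF _ _ _ _ assms(2)])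
  fix g assume "g \<in> gens n"
  then show "gen_el g * murphy n \<approx>[Suc n] murphy n * gen_el g"
    by (cases g rule: gens_cases) (auto intro: murphy_t murphy_g_below murphy_b)
qed (simp_all add: murphy_free_on)

text \<open>The factor y moves left, past the framing power and past J = \<open>murphy n\<close>,
  until it is absorbed by the coefficient. The second kind of spanning element is the one that calls
  for \<open>murphy_comm\<close>.\<close>

lemma rank_span_right_free_on:
  assumes n: "1 \<le> n" and y: "y \<in> free_on n" and x: "rank_span n (murphy n) x"
  shows "rank_span n (murphy n) (x * y)"
  using x
proof (induction rule: rank_span.induct)
  have t: "y * ft (Suc n) ^ k \<approx>[Suc n] ft (Suc n) ^ k * y" for k
    by (rule lower_part_comm_t) (use n y in \<open>simp add: lower_part_pos\<close>)
  {
    case (frame a k)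
    then have "a \<in> free_on n" using n by (simp add: lower_part_pos)
    with rank_span.equiv[OF rank_span.frame[of "a * y" n] cong_mult_left[OF t, of a k, unfolded mult.assoc[symmetric]]]
    show ?case using n y by (simp add: lower_part_pos mult.assoc)
  next
    case (loop a k)
    then have a: "a \<in> free_on n" using n by (simp add: lower_part_pos)
    have "(a * y) * murphy n * ft (Suc n) ^ k = a * (y * murphy n) * ft (Suc n) ^ k" by (simp add: mult.assoc)
    also have "\<dots> \<approx>[Suc n] a * (murphy n * y) * ft (Suc n) ^ k"
      using a by (intro cong_ctx murphy_comm n y) simp_all
    also have "\<dots> = (a * murphy n) * (y * ft (Suc n) ^ k)" by (simp add: mult.assoc)
    also have "\<dots> \<approx>[Suc n] (a * murphy n) * (ft (Suc n) ^ k * y)"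
      using a by (intro cong_mult_left t) (simp add: murphy_free_on)
    finally show ?case
      using rank_span.equiv[OF rank_span.loop[of "a * y" n]] a n y by (simp add: lower_part_pos mult.assoc)
  next
    case (braid a b)
    then show ?case using rank_span.braid[of n a "b * y"] y by (simp add: mult.assoc)
  next
    case (add x y)
    then show ?case using rank_span.add by (simp add: distrib_right)
  next
    case (equiv x x')
    then show ?case using rank_span.equiv cong_mult_right[of "Suc n" x x' y] y by simp
  }
qed

text \<open>The hard case is g_n as the next letter of a word. With J = \<open>murphy n\<close>:
  after a t_(n+1)^k it gives the third kind; after a J t_(n+1)^k the question reduces to J g_n;
  after a g_n b it forms a sandwich, in which b is resolved by the induction hypothesis on the
  rank.\<close>

theorem span_murphy: "x \<in> free_on (Suc n) \<Longrightarrow> rank_span n (murphy n) x"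
proof (induction n arbitrary: x)
  case 0
  from 0 show ?case
  proof (induction rule: free_on_induct)
    case (scalar c)
    show ?case using rank_span.frame[of "scalar c" 0 _ 0] by simp
  next
    case (gen x g)
    from \<open>g \<in> gens (Suc 0)\<close> show ?case
    proof (cases rule: gens_cases)
      case (1 j)
      then show ?thesis using rank_span_right_t[OF gen.IH, of 1] by simp
    next
      case 2
      then show ?thesis by simp
    next
      case 3
      have tb: "ft 1 ^ k * fb \<approx>[Suc 0] fb * ft 1 ^ k" for k
        by (intro intertwine_power t_b) auto
      have b: "rank_span 0 fb (fb * ft 1 ^ k)" for k
        using rank_span.loop[of 1 0 fb k] by simp
      have bb: "rank_span 0 fb (fb * fb)"
      proof (rule rank_span.equiv[OF _ cong_sym[OF b_square]])
        have "rank_span 0 fb (ft 1 ^ k * fb)" for k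
          by (rule rank_span.equiv[OF b cong_sym[OF tb]])
        then show "rank_span 0 fb (1 + scalar (ind_v - inverse ind_v) * idem_f d 1 * fb)"
          using rank_span.frame[of 1 0 fb 0]
          by (auto simp: idem_f_def mult.assoc sum_distrib_right intro!: rank_span.add rank_span_scalar rank_span_sum)
      qed simp
      have "rank_span 0 fb (x * fb)" if "rank_span 0 fb x" for x
        using that
      proof (induction rule: rank_span.induct)
        case (frame a k)
        have "rank_span 0 fb (ft 1 ^ k * fb)" by (rule rank_span.equiv[OF b cong_sym[OF tb]])
        then show ?case using rank_span_left frame by (simp add: mult.assoc)
      next
        case (loop a k)
        have "rank_span 0 fb ((fb * fb) * ft (Suc 0) ^ k)" by (rule rank_span_right_t[OF bb])
        then have "rank_span 0 fb (fb * (ft 1 ^ k * fb))"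
          by (rule rank_span.equiv) (use cong_mult_left[OF cong_sym[OF tb], of fb k] in \<open>simp add: mult.assoc\<close>)
        then show ?case using rank_span_left loop by (simp add: mult.assoc)
      next
        case (add x y)
        then show ?case using rank_span.add by (simp add: distrib_right)
      next
        case (equiv x x')
        then show ?case using rank_span.equiv cong_mult_right[of "Suc 0" x x' fb] by simp
      qed simp
      then show ?thesis using gen 3 by simp
    qed
  qed (rule rank_span.add)
next
  case (Suc m)
  let ?n = "Suc m" and ?N = "Suc (Suc m)" and ?g = "fg (Suc m)"
  let ?J = "murphy ?n"
  have J: "?J \<in> free_on ?N" "murphy m \<in> free_on ?n" by (simp_all add: murphy_free_on del: murphy.simps)
  have sand: "rank_span ?n ?J (?g * x * ?g)" if "x \<in> free_on ?n" for x
    using rank_span_sandwich[OF J(2) _ Suc.IH[OF that], of ?J] rank_span.loop[of 1 ?n ?J 0] by simp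
  have tg: "ft ?N ^ k * ?g \<approx>[?N] ?g * ft ?n ^ k" "ft ?n ^ k * ?g \<approx>[?N] ?g * ft ?N ^ k" for k
    by (intro intertwine_power t_g_same t_g_Suc; simp)+
  \<comment> \<open>With J' = \<open>murphy m\<close> and n = m + 1, J g_n = (g_n J') g_n^2. The
    constant term of the quadratic relation leaves g_n J', of the third kind; in the other term the
    framings cross the last g_n and leave J t_(n+1)^s t_n^r.\<close>
  have Jg: "rank_span ?n ?J (?J * ?g)"
  proof -
    have s: "rank_span ?n ?J ((?g * murphy m) * (ft ?n ^ s * ft ?N ^ r) * ?g)" for s r
    proof (rule rank_span.equiv)
      have "ft ?n ^ s * ft ?N ^ r * ?g \<approx>[?N] ?g * (ft ?N ^ s * ft ?n ^ r)"
        by (intro intertwine_prod tg) simp_all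
      from cong_mult_left[OF cong_sym[OF this], of "?g * murphy m"]
      show "?g * (murphy m * ?g * ft ?N ^ s * ft ?n ^ r) \<approx>[?N] (?g * murphy m) * (ft ?n ^ s * ft ?N ^ r) * ?g"
        using J by (simp add: mult.assoc)
      have "rank_span ?n ?J (1 * ?J * ft ?N ^ s)" by (rule rank_span.loop) simp
      then have "rank_span ?n ?J (1 * ?J * ft ?N ^ s * ft ?n ^ r)" by (rule rank_span_right_free_on[rotated 2]) simp_all
      then show "rank_span ?n ?J (?g * (murphy m * ?g * ft ?N ^ s * ft ?n ^ r))" by (simp add: mult.assoc)
    qed
    have "rank_span ?n ?J (1 * ?g * murphy m)" using J by (intro rank_span.braid) simp_all
    then have "rank_span ?n ?J ((?g * murphy m) * (1 + scalar (ind_u - inverse ind_u) * idem_e d ?n * ?g))"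
      using rank_span.add[OF _ rank_span_idem_e[OF s]] by (simp add: distrib_left mult.assoc)
    then have "rank_span ?n ?J ((?g * murphy m) * (?g * ?g))"
      by (rule rank_span.equiv) (use J in \<open>intro cong_mult_left cong_sym[OF g_square]; simp\<close>)
    then show ?thesis by (simp add: mult.assoc)
  qed
  have right_g: "rank_span ?n ?J (x * ?g)" if "rank_span ?n ?J x" for x
    using that
  proof (induction rule: rank_span.induct)
    case (frame a k)
    then have a: "a \<in> free_on ?n" by (simp add: lower_part_pos)
    have "rank_span ?n ?J (a * ?g * ft ?n ^ k)" using a by (intro rank_span.braid) simp_all
    then show ?case
      by (rule rank_span.equiv) (use cong_mult_left[OF cong_sym[OF tg(1)], of a k] a in \<open>simp add: mult.assoc\<close>)
  next
    case (loop a k)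
    then have a: "a \<in> free_on ?n" by (simp add: lower_part_pos)
    have "rank_span ?n ?J (a * (?J * ?g) * ft ?n ^ k)"
      using a by (intro rank_span_right_free_on rank_span_left[OF Jg]) (simp_all add: lower_part_pos)
    then show ?case
      by (rule rank_span.equiv) (use cong_mult_left[OF cong_sym[OF tg(1)], of "a * ?J" k] a J(1) in \<open>simp add: mult.assoc del: murphy.simps\<close>)
  next
    case (braid a b)
    then have "rank_span ?n ?J (a * (?g * b * ?g))" by (intro rank_span_left[OF sand]) (simp_all add: lower_part_pos)
    then show ?case by (simp add: mult.assoc)
  next
    case (add x y)
    then show ?case using rank_span.add by (simp add: distrib_right)
  next
    case (equiv x x')
    then show ?case using rank_span.equiv cong_mult_right[of ?N x x' ?g] by simp
  qed
  from Suc.prems show ?case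
  proof (induction rule: free_on_induct)
    case (scalar c)
    show ?case using rank_span.frame[of "scalar c" ?n _ 0] by simp
  next
    case (gen x g)
    from gen(2) consider "g \<in> gens ?n" | "g = Framing ?N" | "g = Braiding ?n"
      by (cases g) (auto simp: le_Suc_eq less_Suc_eq)
    then show ?case
    proof cases
      case 1
      then show ?thesis using gen by (intro rank_span_right_free_on) simp_all
    next
      case 2
      then show ?thesis using rank_span_right_t[OF gen.IH, of 1] by simp
    next
      case 3
      then show ?thesis using right_g gen by simp
    qed
  qed (rule rank_span.add)
qed

section \<open>From the Jucys-Murphy type elements to the b_k of the trace rules\<close>

definition g_inv :: "nat \<Rightarrow> free_el" where
  "g_inv i = fg i - scalar (ind_u - inverse ind_u) * idem_e d i"

lemma g_inv_free_on [simp]: "1 \<le> i \<Longrightarrow> i < n \<Longrightarrow> g_inv i \<in> free_on n"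
  by (simp add: g_inv_def)

text \<open>\<open>loop_rep k\<close> represents \<open>b\<^sub>k\<^sub>+\<^sub>1\<close>.\<close>

fun loop_rep :: "nat \<Rightarrow> free_el" where
  "loop_rep 0 = fb"
| "loop_rep (Suc k) = fg (Suc k) * loop_rep k * g_inv (Suc k)"

lemma loop_rep_free_on: "k < n \<Longrightarrow> loop_rep k \<in> free_on n"
  by (induction k) simp_all

text \<open>By the sandwich lemma it is enough to treat g_n b g_n with b of one rank less, and
  writing the last g_n as g_n^(-1) + (u - 1/u) e_n splits off the next b. In the remaining term
  t_(n+1)^r moves left out of e_n, past b and across g_n, which leaves the third kind.\<close>

lemma rank_span_loop_rep_murphy: "rank_span n (loop_rep n) (murphy n)"
proof (induction n)
  case 0
  then show ?case using rank_span.loop[of 1 0 fb 0] by simp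
next
  case (Suc m)
  let ?n = "Suc m" and ?N = "Suc (Suc m)" and ?g = "fg (Suc m)"
  have b: "loop_rep m \<in> free_on ?n" by (simp add: loop_rep_free_on)
  have s: "rank_span ?n (loop_rep ?n) ((?g * loop_rep m) * (ft ?n ^ s * ft ?N ^ r) * 1)" for s r
  proof (rule rank_span.equiv)
    show "rank_span ?n (loop_rep ?n) (ft ?n ^ r * ?g * (loop_rep m * ft ?n ^ s))"
      using b by (intro rank_span.braid) simp_all
    have "ft ?n ^ r * ?g * (loop_rep m * ft ?n ^ s) \<approx>[?N] ?g * ft ?N ^ r * (loop_rep m * ft ?n ^ s)"
      using b by (intro cong_mult_right intertwine_power t_g_same) simp_all
    also have "\<dots> = ?g * (ft ?N ^ r * (loop_rep m * ft ?n ^ s))" by (simp add: mult.assoc)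
    also have "\<dots> \<approx>[?N] ?g * ((loop_rep m * ft ?n ^ s) * ft ?N ^ r)"
      using b by (intro cong_mult_left cong_sym[OF lower_part_comm_t]) (simp_all add: lower_part_pos)
    finally show "ft ?n ^ r * ?g * (loop_rep m * ft ?n ^ s) \<approx>[?N] (?g * loop_rep m) * (ft ?n ^ s * ft ?N ^ r) * 1"
      by (simp add: mult.assoc)
  qed
  have "?g * loop_rep m * ?g = loop_rep ?n + (?g * loop_rep m) * (scalar (ind_u - inverse ind_u) * idem_e d ?n) * 1"
    by (simp add: g_inv_def algebra_simps)
  moreover have "rank_span ?n (loop_rep ?n) (loop_rep ?n)"
    using rank_span.loop[of 1 ?n "loop_rep ?n" 0] by simp
  ultimately have "rank_span ?n (loop_rep ?n) (?g * loop_rep m * ?g)"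
    using rank_span.add[OF _ rank_span_idem_e[OF s]] by simp
  then show ?case using rank_span_sandwich[OF b _ Suc.IH] by simp
qed

theorem span_loop_rep: "x \<in> free_on (Suc n) \<Longrightarrow> rank_span n (loop_rep n) x"
  using rank_span_subst[OF rank_span_loop_rep_murphy span_murphy] .

end

section \<open>The scalar field and its characters\<close>

lemma const_cuv_mult: "const_cuv (a * b) = const_cuv a * const_cuv b"
  by (simp add: const_cuv_def)

lemma const_cuv_add: "const_cuv (a + b) = const_cuv a + const_cuv b"
  by (simp add: const_cuv_def)

lemma const_cuv_0: "const_cuv 0 = 0"
  by (simp add: const_cuv_def Zero_fract_def)
lemma const_cuv_1 [simp]: "const_cuv 1 = 1"
  by (simp add: const_cuv_def One_fract_def one_pCons)

lemma const_cuv_of_nat: "const_cuv (of_nat k) = of_nat k"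
  by (induction k) (simp_all add: const_cuv_add const_cuv_0)

lemma const_cuv_inj: "const_cuv a = 0 \<longleftrightarrow> a = 0"
  by (simp add: const_cuv_def Zero_fract_def eq_fract)

lemma of_nat_cuv_eq_0 [simp]: "(of_nat k :: cuv) = 0 \<longleftrightarrow> k = 0"
  using const_cuv_inj[of "of_nat k"] by (simp add: const_cuv_of_nat)

section \<open>Characters of Z/dZ and their orthogonality\<close>

lemma chi_add: "chi d m (a + b) = chi d m a * chi d m b"
  by (simp add: chi_def add_divide_distrib distrib_left exp_add const_cuv_mult)

lemma chi_0 [simp]: "chi d m 0 = 1"
  by (simp add: chi_def)

lemma chi_period: "chi d m d = 1"
proof (cases "d = 0")
  case False
  then show ?thesis using complex_root_unity_eq_1[of d "m * d"] by (simp add: chi_def mult.assoc)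
qed simp

lemma chi_mod: "chi d m (a mod d) = chi d m a"
proof -
  have "chi d m (d * q) = 1" for q
    by (induction q) (simp_all add: chi_add chi_period)
  then show ?thesis
    using chi_add[of d m "d * (a div d)" "a mod d"] by simp
qed

lemma chi_diff_mult:
  assumes "s \<le> d" shows "chi d m (d - s) * chi d m s = 1"
  using assms chi_add[of d m "d - s" s] by (simp add: chi_period)

lemma chi_ne_0 [simp]: "chi d m a \<noteq> 0"
  by (simp add: chi_def const_cuv_inj)

lemma root_power_sum_0:
  fixes q :: cuv
  assumes "q ^ d = 1" "q \<noteq> 1"
  shows "(\<Sum>s<d. q ^ s) = 0"
  using geometric_sum[OF assms(2), of d] assms by simp

lemma chi_power: "chi d m (a * k) = chi d m a ^ k"
  by (induction k) (simp_all add: chi_add)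

lemma chi_sym: "chi d m a = chi d a m"
  by (simp add: chi_def mult_ac)

lemma const_cuv_eq_iff: "const_cuv a = const_cuv b \<longleftrightarrow> a = b"
  by (simp add: const_cuv_def eq_fract)

lemma chi_inj:
  assumes "a < d" "b < d" "chi d a 1 = chi d b 1"
  shows "a = b"
proof -
  from assms(3) have "exp (2 * complex_of_real pi * \<i> * of_nat a / of_nat d) = exp (2 * complex_of_real pi * \<i> * of_nat b / of_nat d)"
    by (simp add: chi_def const_cuv_eq_iff)
  then show ?thesis using complex_root_unity_eq[of d a b] assms by simp
qed

text \<open>A geometric sum whose ratio is a d-th root of unity other than 1. The argument d - s
  stands for -s; the shift k is there because a framing power t^k of a spanning element gets
  multiplied by the t^s of the idempotent.\<close>

lemma chi_orthogonal:
  assumes "l < d" "m < d" "l \<noteq> m"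
  shows "(\<Sum>s<d. chi d m (d - s) * chi d l (k + s)) = 0"
proof -
  define q where "q = chi d l 1 / chi d m 1"
  have "chi d l 1 \<noteq> chi d m 1" using assms chi_inj by metis
  then have "q \<noteq> 1" by (simp add: q_def)
  moreover have "q ^ d = 1"
    using chi_power[of d l 1 d] chi_power[of d m 1 d] by (simp add: q_def power_divide chi_period)
  ultimately have 0: "(\<Sum>s<d. q ^ s) = 0" by (rule root_power_sum_0[rotated])
  have "chi d m (d - s) * chi d l (k + s) = chi d l k * q ^ s" if "s < d" for s
  proof -
    have "chi d m (d - s) = 1 / chi d m s"
      using chi_diff_mult[of s d m] that by (simp add: field_simps)
    then show ?thesis
      using chi_power[of d l 1 s] chi_power[of d m 1 s] by (simp add: q_def chi_add power_divide)
  qed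
  then have "(\<Sum>s<d. chi d m (d - s) * chi d l (k + s)) = chi d l k * (\<Sum>s<d. q ^ s)"
    by (simp add: sum_distrib_left)
  with 0 show ?thesis by simp
qed

text \<open>The formula for \<open>chi\<close> is symmetric in index and argument, so a sum over
  characters is also a sum over arguments, here for the characters 0 and s.\<close>

lemma chi_sum_char:
  assumes "0 < s" "s < d"
  shows "(\<Sum>m<d. chi d m s) = 0"
proof -
  have "(\<Sum>m<d. chi d 0 (d - m) * chi d s (0 + m)) = 0"
    using assms by (intro chi_orthogonal) auto
  then show ?thesis by (simp add: chi_sym[of d 0] chi_sym[of d s])
qed

lemma ind_u_ne_0 [simp]: "ind_u \<noteq> 0"
  by (simp add: ind_u_def Zero_fract_def eq_fract)

text \<open>Needed for the denominator of z: u is an indeterminate, so the polynomial u^2 + 1 is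
  nonzero although it has complex roots.\<close>

lemma ind_u_sq_ne [simp]: "ind_u ^ 2 + 1 \<noteq> 0" "1 + ind_u ^ 2 \<noteq> 0"
proof -
  have "ind_u ^ 2 + 1 = Fraction_Field.Fract [:[:1, 0, 1:]:] 1"
    by (simp add: ind_u_def power2_eq_square One_fract_def one_pCons)
  then show "ind_u ^ 2 + 1 \<noteq> 0" by (simp add: Zero_fract_def eq_fract)
  then show "1 + ind_u ^ 2 \<noteq> 0" by (simp add: add.commute)
qed

section \<open>The trace\<close>

context framing_modulus
begin

section \<open>Classes in the Yokonuma-Hecke algebra and their representatives\<close>

lemma ring_yokonuma: "1 \<le> n \<Longrightarrow> ring (yokonuma d n)"
  unfolding yokonuma_def by (intro ring_quot_algebra yokonuma_ideal_ideal)

lemma yok_class_image: "yok_class d n a = (\<lambda>h. h + a) ` yokonuma_ideal d n"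
  by (auto simp: yok_class_def a_r_coset_def' free_algebra_simps)

lemma mem_yok_class: "1 \<le> n \<Longrightarrow> a \<in> free_on n \<Longrightarrow> y \<in> yok_class d n a \<longleftrightarrow> y \<approx>[n] a"
proof -
  assume n: "1 \<le> n" and a: "a \<in> free_on n"
  have "y \<in> yok_class d n a \<longleftrightarrow> y - a \<in> yokonuma_ideal d n"
    unfolding yok_class_image by (auto simp: image_iff intro: bexI[of _ "y - a"])
  moreover have "y \<in> free_on n" if "y - a \<in> yokonuma_ideal d n"
    using free_on_add[OF ideal_lower_part[OF n that] a] by simp
  ultimately show ?thesis using n a by (auto simp: cong_def)
qed

lemma yok_class_eq: "a \<approx>[n] b \<Longrightarrow> yok_class d n a = yok_class d n b"
  by (intro Set.set_eqI) (meson cong_ge1 cong_free_on1 cong_free_on2 mem_yok_class cong_trans cong_sym)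

lemma yok_class_carrier: "1 \<le> n \<Longrightarrow> a \<in> free_on n \<Longrightarrow> yok_class d n a \<in> carrier (yokonuma d n)"
  by (auto simp: yokonuma_def quot_algebra_sel FactRing_simps yok_class_def)

lemma yok_class_mult: "1 \<le> n \<Longrightarrow> a \<in> free_on n \<Longrightarrow> b \<in> free_on n \<Longrightarrow>
    yok_class d n a \<otimes>\<^bsub>yokonuma d n\<^esub> yok_class d n b = yok_class d n (a * b)"
  using ideal.rcoset_mult_add[OF yokonuma_ideal_ideal, of n a b]
  by (simp add: yokonuma_def quot_algebra_sel FactRing_def yok_class_def free_algebra_simps)

lemma yok_class_add: "1 \<le> n \<Longrightarrow> a \<in> free_on n \<Longrightarrow> b \<in> free_on n \<Longrightarrow>
    yok_class d n a \<oplus>\<^bsub>yokonuma d n\<^esub> yok_class d n b = yok_class d n (a + b)"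
  using ideal.a_rcos_sum[OF yokonuma_ideal_ideal, of n a b]
  by (simp add: yokonuma_def quot_algebra_sel FactRing_def yok_class_def free_algebra_simps)

lemma yok_class_one: "\<one>\<^bsub>yokonuma d n\<^esub> = yok_class d n 1"
  by (simp add: yokonuma_def quot_algebra_sel FactRing_def yok_class_def free_algebra_simps)

lemma yok_class_smult:
  assumes "1 \<le> n" "a \<in> free_on n"
  shows "c \<odot>\<^bsub>yokonuma d n\<^esub> yok_class d n a = yok_class d n (scalar c * a)"
proof -
  have "yok_class d n (scalar c * x) = yok_class d n (scalar c * a)" if "x \<in> yok_class d n a" for x
    using that assms by (intro yok_class_eq cong_mult_left) (simp_all add: mem_yok_class)
  moreover have "a \<in> yok_class d n a" using assms by (simp add: mem_yok_class cong_refl)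
  ultimately have "(\<Union>x\<in>yok_class d n a. yok_class d n (scalar c * x)) = yok_class d n (scalar c * a)"
    by (intro SUP_eq_const) blast+
  then show ?thesis
    by (simp only: yokonuma_def quot_algebra_sel free_algebra_simps yok_class_def)
qed

lemma yok_class_power:
  assumes n: "1 \<le> n" "a \<in> free_on n"
  shows "yok_class d n a [^]\<^bsub>yokonuma d n\<^esub> (k::nat) = yok_class d n (a ^ k)"
  using assms
  by (induction k) (simp_all add: Group.nat_pow_def yok_class_one yok_class_mult power_commutes)

lemma yok_incl_class:
  assumes "1 \<le> n" "a \<in> free_on n"
  shows "yok_incl d n (yok_class d n a) = yok_class d (Suc n) a"
proof -
  have "yok_class d (Suc n) x = yok_class d (Suc n) a" if "x \<in> yok_class d n a" for x
    using that assms by (intro yok_class_eq cong_Suc) (simp_all add: mem_yok_class)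
  moreover have "a \<in> yok_class d n a" using assms by (simp add: mem_yok_class cong_refl)
  ultimately show ?thesis
    unfolding yok_incl_def Suc_eq_plus1[symmetric] by (intro SUP_eq_const) blast+
qed

text \<open>g_i swaps t_i and t_(i+1), which turns the summand for s into the one for d - s, and an
  average over Z/dZ is insensitive to the sign.\<close>

lemma e_g:
  assumes "i \<in> {1..<n}"
  shows "idem_e d i * fg i \<approx>[n] fg i * idem_e d i"
proof -
  define A where "A s = ft i ^ s * ft (Suc i) ^ (d - s)" for s
  have A: "A s \<in> free_on n" for s using assms by (simp add: A_def)
  have "A s * fg i \<approx>[n] fg i * A (d - s)" if "s < d" for s
  proof -
    have "A s * fg i \<approx>[n] fg i * (ft (Suc i) ^ s * ft i ^ (d - s))"
      unfolding A_def using assms by (intro intertwine_prod intertwine_power t_g_same t_g_Suc) auto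
    also have "\<dots> \<approx>[n] fg i * (ft i ^ (d - s) * ft (Suc i) ^ s)"
    proof (intro cong_mult_left)
      have "ft i ^ (d - s) * ft (Suc i) \<approx>[n] ft (Suc i) * ft i ^ (d - s)"
        using assms by (intro intertwine_power t_comm) auto
      from intertwine_power[OF cong_sym[OF this], of s]
      show "ft (Suc i) ^ s * ft i ^ (d - s) \<approx>[n] ft i ^ (d - s) * ft (Suc i) ^ s"
        using assms by simp
    qed (use assms in auto)
    finally show ?thesis using that by (simp add: A_def)
  qed
  then have "(\<Sum>s<d. A s) * fg i \<approx>[n] fg i * (\<Sum>s<d. A (d - s))"
    using assms by (intro intertwine_sum) auto
  \<comment> \<open>While s runs through 0, ..., d - 1, the number d - s runs through 1, ..., d. The
    two sums thus differ by \<open>A d\<close> and \<open>A 0\<close>, both congruent to 1 because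
    t^d = 1.\<close>
  also have "(\<Sum>s<d. A (d - s)) = (\<Sum>s<d. A (Suc (d - Suc s)))"
    by (intro sum.cong) (auto simp: Suc_diff_Suc)
  also have "\<dots> = (\<Sum>s<d. A (Suc s))" by (rule sum.nat_diff_reindex)
  also have "\<dots> = (\<Sum>s<d. A s) + A d - A 0"
    using sum.lessThan_Suc_shift[of A d] by simp
  also have "fg i * \<dots> \<approx>[n] fg i * ((\<Sum>s<d. A s) + 1 - 1)"
  proof (intro cong_mult_left cong_diff cong_add cong_refl)
    show "A d \<approx>[n] 1" "A 0 \<approx>[n] 1"
      using t_order[of i n] t_order[of "Suc i" n] assms by (simp_all add: A_def)
  qed (use assms A in auto)
  finally have "(\<Sum>s<d. A s) * fg i \<approx>[n] fg i * (\<Sum>s<d. A s)" by simp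
  from intertwine_scalar_mult[OF this] show ?thesis by (simp add: idem_e_def A_def)
qed

text \<open>The quadratic relation has e_i to the left of g_i and so yields the left inverse
  directly; for the right inverse e_i is first moved by \<open>e_g\<close>.\<close>

lemma g_g_inv:
  assumes "i \<in> {1..<n}"
  shows "fg i * g_inv i \<approx>[n] 1" "g_inv i * fg i \<approx>[n] 1"
proof -
  let ?c = "scalar (ind_u - inverse ind_u)"
  have F: "idem_e d i \<in> free_on n" "fg i \<in> free_on n" "1 \<le> n" using assms by auto
  have "fg i * fg i - ?c * (idem_e d i * fg i)
      \<approx>[n] 1 + ?c * idem_e d i * fg i - ?c * (idem_e d i * fg i)"
    using F by (intro cong_diff g_square assms cong_refl) auto
  then show 2: "g_inv i * fg i \<approx>[n] 1" by (simp add: g_inv_def algebra_simps)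
  have "fg i * fg i - ?c * (fg i * idem_e d i)
      \<approx>[n] 1 + ?c * idem_e d i * fg i - ?c * (idem_e d i * fg i)"
    using F by (intro cong_diff g_square assms cong_mult_left cong_sym[OF e_g]) auto
  then show "fg i * g_inv i \<approx>[n] 1" by (simp add: g_inv_def algebra_simps mult_scalar_left[of "fg i"])
qed

text \<open>This is b_1^(-1), found by solving the quadratic relation of the loop for 1.\<close>

definition b_inv :: free_el where
  "b_inv = fb - scalar (ind_v - inverse ind_v) * idem_f d 1"

lemma b_inv_free_on [simp]: "1 \<le> n \<Longrightarrow> b_inv \<in> free_on n"
  by (simp add: b_inv_def)

lemma b_b_inv:
  assumes "1 \<le> n"
  shows "fb * b_inv \<approx>[n] 1" "b_inv * fb \<approx>[n] 1"
proof -
  let ?c = "scalar (ind_v - inverse ind_v)"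
  have F: "idem_f d 1 \<in> free_on n" "fb \<in> free_on n" using assms by auto
  have fb: "idem_f d 1 * fb \<approx>[n] fb * idem_f d 1"
    unfolding idem_f_def using assms by (intro intertwine_scalar_mult intertwine_sum intertwine_power t_b) auto
  have "fb * fb - ?c * (idem_f d 1 * fb) \<approx>[n] 1 + ?c * idem_f d 1 * fb - ?c * (idem_f d 1 * fb)"
    using F assms by (intro cong_diff b_square cong_refl) auto
  then show "b_inv * fb \<approx>[n] 1" by (simp add: b_inv_def algebra_simps)
  have "fb * fb - ?c * (fb * idem_f d 1) \<approx>[n] 1 + ?c * idem_f d 1 * fb - ?c * (idem_f d 1 * fb)"
    using F assms by (intro cong_diff b_square cong_mult_left cong_sym[OF fb]) auto
  then show "fb * b_inv \<approx>[n] 1" by (simp add: b_inv_def algebra_simps mult_scalar_left[of fb])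
qed

definition inv_el :: "gen \<Rightarrow> free_el" where
  "inv_el g = (case g of Framing j \<Rightarrow> ft j ^ (d - 1) | Braiding i \<Rightarrow> g_inv i | Loop \<Rightarrow> b_inv)"

lemma inv_el_free_on: "1 \<le> n \<Longrightarrow> g \<in> gens n \<Longrightarrow> inv_el g \<in> free_on n"
  by (cases g) (simp_all add: inv_el_def)

lemma gen_inv_el:
  assumes "1 \<le> n" "g \<in> gens n"
  shows "gen_el g * inv_el g \<approx>[n] 1" "inv_el g * gen_el g \<approx>[n] 1"
proof -
  have "ft j * ft j ^ (d - 1) = ft j ^ d" "ft j ^ (d - 1) * ft j = ft j ^ d" for j
    using d_pos power_minus_mult[of d "ft j"] by (simp_all flip: power_Suc)
  then have "gen_el g * inv_el g \<approx>[n] 1 \<and> inv_el g * gen_el g \<approx>[n] 1"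
    using assms t_order g_g_inv b_b_inv by (cases g) (auto simp: inv_el_def)
  then show "gen_el g * inv_el g \<approx>[n] 1" "inv_el g * gen_el g \<approx>[n] 1" by auto
qed

text \<open>\<open>inv\<close> is defined by description, so it is identified by exhibiting a
  two-sided inverse. It occurs both in the b_k of the trace rules and in the image of a braid
  word.\<close>

lemma yok_gen_inv:
  assumes "1 \<le> n" "g \<in> gens n"
  shows "inv\<^bsub>yokonuma d n\<^esub> (yok_gen d n g) = yok_class d n (inv_el g)"
proof -
  interpret ring "yokonuma d n" by (rule ring_yokonuma[OF assms(1)])
  show ?thesis
    unfolding yok_gen_def
    by (rule inv_char)
      (use assms gen_inv_el[OF assms] in
        \<open>auto simp: yok_class_mult yok_class_one inv_el_free_on intro!: yok_class_carrier yok_class_eq\<close>)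
qed

lemma loop_conj_eq: "k < n \<Longrightarrow> loop_conj d n (Suc k) = yok_class d n (loop_rep k)"
proof (induction k)
  case 0
  then show ?case by (simp add: yok_gen_def)
next
  case (Suc k)
  have "inv\<^bsub>yokonuma d n\<^esub> (yok_gen d n (Braiding (Suc k))) = yok_class d n (g_inv (Suc k))"
    using yok_gen_inv[of n "Braiding (Suc k)"] Suc.prems by (simp add: inv_el_def)
  then show ?case using Suc loop_rep_free_on[of k n] by (simp add: yok_gen_def yok_class_mult)
qed

text \<open>The idempotent projecting onto the eigenspace of \<open>t\<^sub>j\<close> for the character \<open>\<chi>\<^sub>m\<close>.\<close>

definition char_idem :: "nat \<Rightarrow> nat \<Rightarrow> free_el" where
  "char_idem m j = scalar (1 / of_nat d) * (\<Sum>s<d. scalar (chi d m (d - s)) * ft j ^ s)"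

lemma char_idem_free_on: "1 \<le> j \<Longrightarrow> j \<le> n \<Longrightarrow> char_idem m j \<in> free_on n"
  by (simp add: char_idem_def)

text \<open>After exchanging the sums the coefficient of t_j^s is a sum over all characters, which
  vanishes for 0 < s < d. As only exponents below d occur, the identity holds in the free algebra
  itself.\<close>

lemma sum_char_idem: "(\<Sum>m<d. char_idem m j) = 1"
proof -
  have "(\<Sum>m<d. char_idem m j) =
      scalar (1 / of_nat d) * (\<Sum>s<d. scalar (\<Sum>m<d. chi d m (d - s)) * ft j ^ s)"
  proof -
    have "(\<Sum>m<d. \<Sum>s<d. scalar (chi d m (d - s)) * ft j ^ s)
        = (\<Sum>s<d. \<Sum>m<d. scalar (chi d m (d - s)) * ft j ^ s)"
      by (rule sum.swap)
    then show ?thesis by (simp add: char_idem_def scalar_sum sum_distrib_right flip: sum_distrib_left)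
  qed
  also have "\<dots> = scalar (1 / of_nat d) * (\<Sum>s<d. if s = 0 then scalar (of_nat d) else 0)"
    by (intro arg_cong[of _ _ "(*) _"] sum.cong) (auto simp: chi_period chi_sum_char)
  also have "\<dots> = 1"
    using d_pos by (simp add: sum.delta flip: scalar_mult)
  finally show ?thesis .
qed

lemma char_idem_g:
  assumes "i \<in> {1..<n}"
  shows "char_idem m (Suc i) * fg i \<approx>[n] fg i * char_idem m i"
  unfolding char_idem_def using assms
  by (intro intertwine_scalar_mult intertwine_sum intertwine_power t_g_Suc) auto

text \<open>The trace rules prescribe values for exponents below d, while spanning elements carry
  arbitrary ones.\<close>

lemma t_pow_mod:
  assumes "i \<in> {1..n}"
  shows "ft i ^ k \<approx>[n] ft i ^ (k mod d)"
proof -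
  have "(ft i ^ d) ^ (k div d) * ft i ^ (k mod d) \<approx>[n] 1 ^ (k div d) * ft i ^ (k mod d)"
    using assms by (intro cong_mult_right cong_power t_order) auto
  then show ?thesis by (simp flip: power_mult power_add)
qed

end

section \<open>The trace rules on representatives\<close>

locale yok_trace = framing_modulus +
  fixes z :: cuv and xs ys :: "nat \<Rightarrow> cuv" and Tr :: "nat \<Rightarrow> free_el set \<Rightarrow> cuv"
  assumes trace: "markov_trace d z xs ys Tr"
begin

definition tau :: "nat \<Rightarrow> free_el \<Rightarrow> cuv" where "tau n a = Tr n (yok_class d n a)"

lemma tau_cong: "a \<approx>[n] b \<Longrightarrow> tau n a = tau n b"
  by (simp add: tau_def yok_class_eq)

lemma tau_add:
  assumes "1 \<le> n" "a \<in> free_on n" "b \<in> free_on n" shows "tau n (a + b) = tau n a + tau n b"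
proof -
  have "linear_functional (yokonuma d n) (Tr n)"
    using trace assms(1) unfolding markov_trace_def by blast
  then show ?thesis
    using assms by (auto simp: linear_functional_def tau_def yok_class_carrier simp flip: yok_class_add)
qed

lemma tau_scalar:
  assumes "1 \<le> n" "a \<in> free_on n" shows "tau n (scalar c * a) = c * tau n a"
proof -
  have "linear_functional (yokonuma d n) (Tr n)"
    using trace assms(1) unfolding markov_trace_def by blast
  then show ?thesis
    using assms by (auto simp: linear_functional_def tau_def yok_class_carrier simp flip: yok_class_smult)
qed

lemma tau_sum:
  assumes "1 \<le> n" "\<And>i. i \<in> A \<Longrightarrow> f i \<in> free_on n" shows "tau n (sum f A) = (\<Sum>i\<in>A. tau n (f i))"
proof -
  have "tau n 0 = 0" using tau_scalar[of n 0 0] assms(1) by simp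
  with assms(2) show ?thesis
  proof (induction A rule: infinite_finite_induct)
    case (insert i F)
    then show ?case using tau_add[OF assms(1), of "f i" "sum f F"] by simp
  qed simp_all
qed

lemma tau_commute:
  assumes "1 \<le> n" "a \<in> free_on n" "b \<in> free_on n" shows "tau n (a * b) = tau n (b * a)"
proof -
  have "\<forall>X\<in>carrier (yokonuma d n). \<forall>Y\<in>carrier (yokonuma d n).
      Tr n (X \<otimes>\<^bsub>yokonuma d n\<^esub> Y) = Tr n (Y \<otimes>\<^bsub>yokonuma d n\<^esub> X)"
    using trace assms(1) unfolding markov_trace_def by blast
  then show ?thesis
    using assms by (auto simp: tau_def yok_class_carrier simp flip: yok_class_mult)
qed

lemma tau_g:
  assumes "1 \<le> n" "a \<in> free_on n" shows "tau (Suc n) (a * fg n) = z * tau n a"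
proof -
  have "\<forall>X\<in>carrier (yokonuma d n).
      Tr (n + 1) (yok_incl d n X \<otimes>\<^bsub>yokonuma d (n + 1)\<^esub> yok_gen d (n + 1) (Braiding n)) = z * Tr n X"
    using trace assms(1) unfolding markov_trace_def by blast
  from bspec[OF this yok_class_carrier[OF assms]] show ?thesis
    using assms by (simp add: tau_def yok_incl_class yok_gen_def yok_class_mult)
qed

lemma tau_t:
  assumes "1 \<le> n" "a \<in> free_on n" shows "tau (Suc n) (a * ft (Suc n) ^ k) = xs (k mod d) * tau n a"
proof -
  have "\<forall>X\<in>carrier (yokonuma d n). \<forall>m<d.
      Tr (n + 1) (yok_incl d n X
          \<otimes>\<^bsub>yokonuma d (n + 1)\<^esub> yok_gen d (n + 1) (Framing (n + 1)) [^]\<^bsub>yokonuma d (n + 1)\<^esub> m)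
        = xs m * Tr n X"
    using trace assms(1) unfolding markov_trace_def by blast
  from bspec[OF this yok_class_carrier[OF assms]]
  have "tau (Suc n) (a * ft (Suc n) ^ (k mod d)) = xs (k mod d) * tau n a"
    using assms d_pos by (simp add: tau_def yok_incl_class yok_gen_def yok_class_mult yok_class_power)
  moreover have "tau (Suc n) (a * ft (Suc n) ^ k) = tau (Suc n) (a * ft (Suc n) ^ (k mod d))"
    using assms by (intro tau_cong cong_mult_left t_pow_mod) auto
  ultimately show ?thesis by simp
qed

lemma tau_b:
  assumes "1 \<le> n" "a \<in> free_on n" shows "tau (Suc n) (a * loop_rep n * ft (Suc n) ^ k) = ys (k mod d) * tau n a"
proof -
  have "\<forall>X\<in>carrier (yokonuma d n). \<forall>m<d.
      Tr (n + 1) (yok_incl d n X \<otimes>\<^bsub>yokonuma d (n + 1)\<^esub> loop_conj d (n + 1) (n + 1)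
          \<otimes>\<^bsub>yokonuma d (n + 1)\<^esub> yok_gen d (n + 1) (Framing (n + 1)) [^]\<^bsub>yokonuma d (n + 1)\<^esub> m)
        = ys m * Tr n X"
    using trace assms(1) unfolding markov_trace_def by blast
  from bspec[OF this yok_class_carrier[OF assms]]
  have "tau (Suc n) (a * loop_rep n * ft (Suc n) ^ (k mod d)) = ys (k mod d) * tau n a"
    using assms d_pos loop_rep_free_on[of n "Suc n"]
    by (simp add: tau_def yok_incl_class yok_gen_def yok_class_mult yok_class_power loop_conj_eq)
  moreover have "tau (Suc n) (a * loop_rep n * ft (Suc n) ^ k) = tau (Suc n) (a * loop_rep n * ft (Suc n) ^ (k mod d))"
    using assms by (intro tau_cong cong_mult_left t_pow_mod) (auto simp: loop_rep_free_on)
  ultimately show ?thesis by simp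
qed

lemma tau_1_t: "tau 1 (ft 1 ^ k) = xs (k mod d)"
proof -
  have "\<forall>m<d. Tr 1 (yok_gen d 1 (Framing 1) [^]\<^bsub>yokonuma d 1\<^esub> m) = xs m"
    using trace unfolding markov_trace_def by blast
  then have "tau 1 (ft 1 ^ (k mod d)) = xs (k mod d)"
    using d_pos by (simp add: tau_def yok_gen_def yok_class_power)
  moreover have "tau 1 (ft 1 ^ k) = tau 1 (ft 1 ^ (k mod d))"
    by (intro tau_cong t_pow_mod) auto
  ultimately show ?thesis by simp
qed

lemma tau_1_b: "tau 1 (fb * ft 1 ^ k) = ys (k mod d)"
proof -
  have "\<forall>m<d. Tr 1 (yok_gen d 1 Loop \<otimes>\<^bsub>yokonuma d 1\<^esub>
        yok_gen d 1 (Framing 1) [^]\<^bsub>yokonuma d 1\<^esub> m) = ys m"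
    using trace unfolding markov_trace_def by blast
  then have "tau 1 (fb * ft 1 ^ (k mod d)) = ys (k mod d)"
    using d_pos by (simp add: tau_def yok_gen_def yok_class_power yok_class_mult)
  moreover have "tau 1 (fb * ft 1 ^ k) = tau 1 (fb * ft 1 ^ (k mod d))"
    by (intro tau_cong cong_mult_left t_pow_mod) auto
  ultimately show ?thesis by simp
qed

lemma tau_char_idem_expand:
  assumes "1 \<le> j" "j \<le> n" "a \<in> free_on n"
  shows "tau n (a * char_idem m j) = 1 / of_nat d * (\<Sum>s<d. chi d m (d - s) * tau n (a * ft j ^ s))"
proof -
  have "a * char_idem m j = scalar (1 / of_nat d) * (\<Sum>s<d. scalar (chi d m (d - s)) * (a * ft j ^ s))"
    by (simp add: char_idem_def mult_scalar_left[of a] sum_distrib_left)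
  then show ?thesis using assms by (simp add: tau_scalar tau_sum)
qed

text \<open>\<open>X\<close> and \<open>Y\<close> say that the parameters have no component along
  chi_m; they enter on one strand only. The element a is arbitrary in the induction because the
  third kind of spanning element leads to a product a b on n strands.\<close>

lemma tau_char_idem_1_vanishes:
  assumes X: "\<And>k. (\<Sum>s<d. chi d m (d - s) * xs ((k + s) mod d)) = 0"
    and Y: "\<And>k. (\<Sum>s<d. chi d m (d - s) * ys ((k + s) mod d)) = 0"
    and n: "1 \<le> n" and a: "a \<in> free_on n"
  shows "tau n (a * char_idem m 1) = 0"
  using n a
proof (induction n arbitrary: a rule: dec_induct)
  case base
  then have "rank_span 0 (loop_rep 0) a" by (intro span_loop_rep) simp
  then show ?case
  proof (induction rule: rank_span.induct)
    case (frame a k)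
    \<comment> \<open>On one strand the coefficients are scalars, and the third kind of spanning
      element does not occur.\<close>
    then obtain c where "a = scalar c" by (auto simp: lower_part_def)
    moreover have "tau 1 (ft 1 ^ k * char_idem m 1) = 0"
      using X[of k] by (simp add: tau_char_idem_expand tau_1_t[simplified] flip: power_add)
    ultimately show ?case
      using tau_scalar[of 1 "ft 1 ^ k * char_idem m 1" c] by (simp add: mult.assoc char_idem_free_on)
  next
    case (loop a k)
    then obtain c where "a = scalar c" by (auto simp: lower_part_def)
    moreover have "tau 1 (fb * ft 1 ^ k * char_idem m 1) = 0"
      using Y[of k] by (subst tau_char_idem_expand) (simp_all add: tau_1_b[simplified] mult.assoc flip: power_add)
    ultimately show ?case
      using tau_scalar[of 1 "fb * ft 1 ^ k * char_idem m 1" c] by (simp add: mult.assoc char_idem_free_on)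
  next
    case (add x y)
    then show ?case
      using rank_span_free_on[of 0 fb] by (simp add: distrib_right tau_add char_idem_free_on)
  next
    case (equiv x y)
    then show ?case
      using tau_cong[OF cong_mult_right[of "Suc 0" x y "char_idem m 1"]] by (simp add: char_idem_free_on)
  qed simp
next
  case (step n)
  have F: "char_idem m 1 \<in> free_on n" "char_idem m 1 \<in> free_on (Suc n)" "loop_rep n \<in> free_on (Suc n)"
    using step by (auto intro: char_idem_free_on loop_rep_free_on)
  have "rank_span n (loop_rep n) a" using step by (intro span_loop_rep) simp
  then show ?case
  proof (induction rule: rank_span.induct)
    case (frame a k)
    then have a: "a \<in> free_on n" using step by (simp add: lower_part_pos)
    have "tau (Suc n) (a * ft (Suc n) ^ k * char_idem m 1) = tau (Suc n) (char_idem m 1 * a * ft (Suc n) ^ k)"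
      using a F by (subst tau_commute) (simp_all add: mult.assoc)
    also have "\<dots> = xs (k mod d) * tau n (a * char_idem m 1)"
      using a F step.hyps tau_commute[of n a "char_idem m 1"] by (subst tau_t) simp_all
    finally show ?case using step.IH[OF a] by simp
  next
    case (loop a k)
    then have a: "a \<in> free_on n" using step by (simp add: lower_part_pos)
    have "tau (Suc n) (a * loop_rep n * ft (Suc n) ^ k * char_idem m 1)
        = tau (Suc n) ((char_idem m 1 * a) * loop_rep n * ft (Suc n) ^ k)"
      using a F by (subst tau_commute) (simp_all add: mult.assoc)
    also have "\<dots> = ys (k mod d) * tau n (a * char_idem m 1)"
      using a F step.hyps tau_commute[of n a "char_idem m 1"] by (subst tau_b) simp_all
    finally show ?case using step.IH[OF a] by simp
  next
    case (braid a b)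
    \<comment> \<open>Cyclicity gathers everything on the left of the single g_n, so that its rule
      applies to an element on n strands.\<close>
    have "tau (Suc n) (a * fg n * b * char_idem m 1) = tau (Suc n) ((b * char_idem m 1 * a) * fg n)"
      using braid F tau_commute[of "Suc n" "a * fg n" "b * char_idem m 1"] by (simp add: mult.assoc)
    also have "\<dots> = z * tau n ((a * b) * char_idem m 1)"
      using braid F tau_commute[of n "b * char_idem m 1" a] by (subst tau_g) (simp_all add: mult.assoc)
    finally show ?case using step.IH[of "a * b"] braid by simp
  next
    case (add x y)
    then show ?case
      using rank_span_free_on F by (simp add: distrib_right tau_add)
  next
    case (equiv x y)
    then show ?case
      using tau_cong[OF cong_mult_right[of "Suc n" x y "char_idem m 1"]] F by simp
  qed
qed

text \<open>Passing from t_(j+1) to t_j replaces a by g_j^(-1) a g_j, so a has to be arbitrary in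
  the induction on j.\<close>

lemma tau_char_idem_vanishes:
  assumes X: "\<And>k. (\<Sum>s<d. chi d m (d - s) * xs ((k + s) mod d)) = 0"
    and Y: "\<And>k. (\<Sum>s<d. chi d m (d - s) * ys ((k + s) mod d)) = 0"
    and j: "1 \<le> j" "j \<le> n" and a: "a \<in> free_on n"
  shows "tau n (a * char_idem m j) = 0"
  using j a
proof (induction j arbitrary: a rule: dec_induct)
  case base
  then show ?case using tau_char_idem_1_vanishes[OF X Y, of n a] by simp
next
  case (step j)
  then have j: "j \<in> {1..<n}" "1 \<le> n" by auto
  have F: "fg j \<in> free_on n" "g_inv j \<in> free_on n" "char_idem m j \<in> free_on n" "char_idem m (Suc j) \<in> free_on n" "a \<in> free_on n"
    using j step by (auto intro: char_idem_free_on)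
  have "a * char_idem m (Suc j) * 1 \<approx>[n] a * char_idem m (Suc j) * (fg j * g_inv j)"
    using F by (intro cong_mult_left cong_sym[OF g_g_inv(1)[OF j(1)]]) simp_all
  also have "\<dots> = a * (char_idem m (Suc j) * fg j) * g_inv j" by (simp add: mult.assoc)
  also have "\<dots> \<approx>[n] a * (fg j * char_idem m j) * g_inv j"
    using F by (intro cong_ctx char_idem_g j)
  finally have "tau n (a * char_idem m (Suc j)) = tau n ((a * fg j * char_idem m j) * g_inv j)"
    using tau_cong by (simp add: mult.assoc)
  also have "\<dots> = tau n ((g_inv j * a * fg j) * char_idem m j)"
    using F j by (subst tau_commute) (simp_all add: mult.assoc)
  also have "\<dots> = 0" using F step by simp
  finally show ?case .
qed

end

section \<open>The specialised parameters\<close>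

lemma x_par_mod: "x_par d S (k mod d) = x_par d S k"
  by (simp add: x_par_def chi_mod)

lemma y_par_mod: "y_par d S S3 S4 (k mod d) = y_par d S S3 S4 k"
  by (simp add: y_par_def chi_mod)

lemma chi_orthogonal_sum:
  assumes "A \<subseteq> {..<d}" "m < d" "m \<notin> A"
  shows "(\<Sum>s<d. chi d m (d - s) * (\<Sum>l\<in>A. chi d l (k + s))) = 0"
proof -
  have "(\<Sum>s<d. chi d m (d - s) * (\<Sum>l\<in>A. chi d l (k + s))) =
      (\<Sum>l\<in>A. \<Sum>s<d. chi d m (d - s) * chi d l (k + s))"
    unfolding sum_distrib_left by (rule sum.swap)
  also have "\<dots> = 0"
    using assms by (intro sum.neutral ballI chi_orthogonal) auto
  finally show ?thesis .
qed

lemma x_par_orthogonal: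
  assumes "S \<subseteq> {..<d}" "m < d" "m \<notin> S"
  shows "(\<Sum>s<d. chi d m (d - s) * x_par d S (k + s)) = 0"
proof -
  have "(\<Sum>s<d. chi d m (d - s) * x_par d S (k + s)) =
      1 / of_nat (card S) * (\<Sum>s<d. chi d m (d - s) * (\<Sum>l\<in>S. chi d l (k + s)))"
    unfolding sum_distrib_left[of "1 / of_nat (card S)"] by (intro sum.cong) (simp_all add: x_par_def)
  then show ?thesis using chi_orthogonal_sum[OF assms] by simp
qed

text \<open>Every summand of y is a multiple of some chi_l with l in S: the first because 0 lies in
  S, the others because S3 and S4 are subsets. An m outside S differs from all these l.\<close>

lemma y_par_orthogonal:
  assumes "S \<subseteq> {..<d}" "0 \<in> S" "S3 \<subseteq> S" "S4 \<subseteq> S" "m < d" "m \<notin> S"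
  shows "(\<Sum>s<d. chi d m (d - s) * y_par d S S3 S4 (k + s)) = 0"
proof -
  define q :: cuv where "q = (ind_v ^ 2 - 1) / (ind_v * (ind_u ^ 2 + 1) * of_nat (card S))"
  have "(\<Sum>s<d. chi d m (d - s) * y_par d S S3 S4 (k + s)) =
      q * (\<Sum>s<d. chi d m (d - s) * (\<Sum>l\<in>{0}. chi d l (k + s)))
      + 1 / of_nat (card S) * ((\<Sum>s<d. chi d m (d - s) * (\<Sum>l\<in>S3. chi d l (k + s)))
         - (\<Sum>s<d. chi d m (d - s) * (\<Sum>l\<in>S4. chi d l (k + s))))"
    unfolding sum_distrib_left[of q] sum_subtractf[symmetric]
      sum_distrib_left[of "1 / of_nat (card S)"] sum.distrib[symmetric]
    by (intro sum.cong) (simp_all add: y_par_def q_def algebra_simps)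
  moreover have "(\<Sum>s<d. chi d m (d - s) * (\<Sum>l\<in>A. chi d l (k + s))) = 0" if "A \<in> {{0}, S3, S4}" for A
    using that assms by (intro chi_orthogonal_sum) auto
  from this[of "{0}"] this[of S3] this[of S4] have "(\<Sum>s<d. chi d m (d - s) * (\<Sum>l\<in>{0}. chi d l (k + s))) = 0"
    "(\<Sum>s<d. chi d m (d - s) * (\<Sum>l\<in>S3. chi d l (k + s))) = 0"
    "(\<Sum>s<d. chi d m (d - s) * (\<Sum>l\<in>S4. chi d l (k + s))) = 0"
    by blast+
  ultimately show ?thesis by (simp only: mult_zero_right diff_self add_0)
qed

locale special_trace =
  yok_trace d "z_par S" "x_par d S" "y_par d S S3 S4" Tr for d S S3 S4 Tr +
  assumes S: "S \<subseteq> {..<d}" "0 \<in> S" "S3 \<subseteq> S - {0}" "S4 \<subseteq> S - {0}"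
begin

lemma card_S: "card S \<noteq> 0"
  using S finite_subset[OF S(1)] by auto

text \<open>Expanding \<open>e\<^sub>n\<close> turns the left-hand side into \<open>E\<close> times the sum of \<open>\<tau>(a \<epsilon>\<^sub>m(t\<^sub>n))\<close> over \<open>m \<in> S\<close>;
  the terms with \<open>m \<notin> S\<close> vanish and the idempotents sum to \<open>1\<close>.\<close>

lemma tau_e:
  assumes "1 \<le> n" "a \<in> free_on n"
  shows "tau (Suc n) (a * idem_e d n) = E_par S * tau n a"
proof -
  have char_idem0: "tau n (a * char_idem m n) = 0" if "m < d" "m \<notin> S" for m
    using that S assms
    by (intro tau_char_idem_vanishes) (auto simp: x_par_mod y_par_mod intro!: x_par_orthogonal y_par_orthogonal)
  have "a * idem_e d n = scalar (1 / of_nat d) * (\<Sum>s<d. (a * ft n ^ s) * ft (Suc n) ^ (d - s))"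
    by (simp add: idem_e_def mult_scalar_left[of a] sum_distrib_left mult.assoc)
  then have "tau (Suc n) (a * idem_e d n) = 1 / of_nat d * (\<Sum>s<d. x_par d S (d - s) * tau n (a * ft n ^ s))"
    using assms by (simp add: tau_scalar tau_sum tau_t x_par_mod)
  also have "\<dots> = 1 / of_nat d * (\<Sum>s<d. E_par S * (\<Sum>m\<in>S. chi d m (d - s) * tau n (a * ft n ^ s)))"
    by (simp add: x_par_def E_par_def sum_distrib_right)
  also have "\<dots> = E_par S * (1 / of_nat d * (\<Sum>s<d. \<Sum>m\<in>S. chi d m (d - s) * tau n (a * ft n ^ s)))"
    by (simp only: mult.left_commute flip: sum_distrib_left)
  also have "\<dots> = E_par S * (\<Sum>m\<in>S. 1 / of_nat d * (\<Sum>s<d. chi d m (d - s) * tau n (a * ft n ^ s)))"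
    unfolding sum.swap[of _ S "{..<d}"] by (simp only: sum_distrib_left)
  also have "\<dots> = E_par S * (\<Sum>m\<in>S. tau n (a * char_idem m n))"
    using assms by (simp add: tau_char_idem_expand)
  also have "(\<Sum>m\<in>S. tau n (a * char_idem m n)) = (\<Sum>m<d. tau n (a * char_idem m n))"
    using S char_idem0 by (intro sum.mono_neutral_left) auto
  also have "\<dots> = tau n (a * (\<Sum>m<d. char_idem m n))"
    using assms by (simp add: sum_distrib_left tau_sum char_idem_free_on)
  also have "\<dots> = tau n a" by (simp add: sum_char_idem)
  finally show ?thesis .
qed

lemma tau_g_inv:
  assumes "1 \<le> n" "a \<in> free_on n"
  shows "tau (Suc n) (a * g_inv n) = (z_par S - (ind_u - inverse ind_u) * E_par S) * tau n a"
proof -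
  have "g_inv n = fg n + scalar (- (ind_u - inverse ind_u)) * idem_e d n"
    by (simp add: g_inv_def scalar_uminus del: minus_diff_eq)
  then have "a * g_inv n = a * fg n + scalar (- (ind_u - inverse ind_u)) * (a * idem_e d n)"
    by (simp only: distrib_left mult_scalar_left[of a])
  then show ?thesis
    using assms by (simp add: tau_add tau_scalar tau_g tau_e del: minus_diff_eq) (simp add: algebra_simps)
qed

end

section \<open>Words, braids and invariance\<close>

abbreviation pres_class ::
    "'g set \<Rightarrow> (('g \<times> bool) list \<times> ('g \<times> bool) list) set \<Rightarrow> ('g \<times> bool) list \<Rightarrow> ('g \<times> bool) list set"
  where "pres_class X R w \<equiv> pres_rel X R `` {w}"

definition inv_word :: "('g \<times> bool) list \<Rightarrow> ('g \<times> bool) list" where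
  "inv_word w = rev (map (\<lambda>(g, s). (g, \<not> s)) w)"

lemma inv_word_lists: "w \<in> lists (X \<times> UNIV) \<Longrightarrow> inv_word w \<in> lists (X \<times> UNIV)"
  by (auto simp: inv_word_def)

lemma pres_rel_iff: "(v, w) \<in> pres_rel X R \<longleftrightarrow> pres_cong X R v w"
  by (simp add: pres_rel_def)

context
  fixes X :: "'g set" and R :: "(('g \<times> bool) list \<times> ('g \<times> bool) list) set"
  assumes R: "\<And>l r. (l, r) \<in> R \<Longrightarrow> l \<in> lists (X \<times> UNIV) \<and> r \<in> lists (X \<times> UNIV)"
begin

lemma pres_cong_words: "pres_cong X R v w \<Longrightarrow> v \<in> lists (X \<times> UNIV) \<and> w \<in> lists (X \<times> UNIV)"
  by (induction rule: pres_cong.induct) (use R in auto)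

lemma pres_cong_ctx:
  assumes "pres_cong X R v w" "a \<in> lists (X \<times> UNIV)" "b \<in> lists (X \<times> UNIV)"
  shows "pres_cong X R (a @ v @ b) (a @ w @ b)"
  using assms(1)
proof (induction rule: pres_cong.induct)
  case (pc_refl w)
  then show ?case using assms by (intro pres_cong.pc_refl) auto
next
  case (pc_cancel p q g s)
  then show ?case using pres_cong.pc_cancel[of "a @ p" X "q @ b" g R s] assms by simp
next
  case (pc_rel p q l r)
  then show ?case using pres_cong.pc_rel[of "a @ p" X "q @ b" l r R] assms by simp
qed (auto intro: pres_cong.pc_sym pres_cong.pc_trans)

lemma pres_cong_append:
  assumes "pres_cong X R v v'" "pres_cong X R w w'"
  shows "pres_cong X R (v @ w) (v' @ w')"
  using pres_cong_ctx[OF assms(1), of "[]" w] pres_cong_ctx[OF assms(2), of v' "[]"]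
    pres_cong_words[OF assms(1)] pres_cong_words[OF assms(2)]
  by (auto intro: pres_cong.pc_trans)


lemma pres_class_eq: "pres_cong X R v w \<Longrightarrow> pres_class X R v = pres_class X R w"
  by (rule Set.set_eqI) (auto simp: pres_rel_iff intro: pres_cong.pc_trans pres_cong.pc_sym)

lemma pres_class_self: "w \<in> lists (X \<times> UNIV) \<Longrightarrow> w \<in> pres_class X R w"
  by (simp add: pres_rel_iff pres_cong.pc_refl)

lemma carrier_presented_group:
  "carrier (presented_group X R) = pres_class X R ` lists (X \<times> UNIV)"
  by (auto simp: presented_group_def quotient_def)

lemma pres_class_carrier: "w \<in> lists (X \<times> UNIV) \<Longrightarrow> pres_class X R w \<in> carrier (presented_group X R)"
  unfolding carrier_presented_group by (rule imageI)

lemma mult_presented_group: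
  assumes "v \<in> lists (X \<times> UNIV)" "w \<in> lists (X \<times> UNIV)"
  shows "pres_class X R v \<otimes>\<^bsub>presented_group X R\<^esub> pres_class X R w = pres_class X R (v @ w)"
proof -
  have "pres_class X R (v' @ w') = pres_class X R (v @ w)"
    if "v' \<in> pres_class X R v" "w' \<in> pres_class X R w" for v' w'
    using that by (intro pres_class_eq pres_cong.pc_sym[OF pres_cong_append]) (simp_all add: pres_rel_iff)
  then have "(\<Union>v'\<in>pres_class X R v. \<Union>w'\<in>pres_class X R w. pres_class X R (v' @ w')) = pres_class X R (v @ w)"
    using pres_class_self[OF assms(1)] pres_class_self[OF assms(2)]
    by (intro SUP_eq_const) blast+
  then show ?thesis by (simp add: presented_group_def)
qed

lemma one_presented_group: "\<one>\<^bsub>presented_group X R\<^esub> = pres_class X R []"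
  by (simp add: presented_group_def)

lemma inv_word_cancel: "w \<in> lists (X \<times> UNIV) \<Longrightarrow> pres_cong X R (inv_word w @ w) []"
proof (induction w)
  case Nil
  then show ?case by (simp add: inv_word_def pres_cong.pc_refl)
next
  case (Cons l w)
  obtain g s where l: "l = (g, s)" by (cases l)
  with Cons have "pres_cong X R (inv_word w @ [(g, \<not> s), (g, \<not> \<not> s)] @ w) (inv_word w @ w)"
    by (intro pres_cong.pc_cancel inv_word_lists) auto
  then have "pres_cong X R (inv_word (l # w) @ l # w) (inv_word w @ w)"
    by (simp add: l inv_word_def)
  with Cons show ?case by (auto intro: pres_cong.pc_trans)
qed

lemma group_presented_group: "group (presented_group X R)"
proof (rule groupI)
  fix x assume "x \<in> carrier (presented_group X R)"
  then obtain w where w: "w \<in> lists (X \<times> UNIV)" "x = pres_class X R w"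
    unfolding carrier_presented_group by blast
  have "pres_class X R (inv_word w) \<otimes>\<^bsub>presented_group X R\<^esub> x = \<one>\<^bsub>presented_group X R\<^esub>"
    using w inv_word_lists[OF w(1)] pres_class_eq[OF inv_word_cancel[OF w(1)]]
    by (simp only: mult_presented_group one_presented_group)
  then show "\<exists>y\<in>carrier (presented_group X R). y \<otimes>\<^bsub>presented_group X R\<^esub> x = \<one>\<^bsub>presented_group X R\<^esub>"
    unfolding carrier_presented_group using inv_word_lists[OF w(1)] by blast
next
  fix x y assume "x \<in> carrier (presented_group X R)" "y \<in> carrier (presented_group X R)"
  then obtain v w where "v \<in> lists (X \<times> UNIV)" "x = pres_class X R v"
    "w \<in> lists (X \<times> UNIV)" "y = pres_class X R w"
    unfolding carrier_presented_group by blast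
  then show "x \<otimes>\<^bsub>presented_group X R\<^esub> y \<in> carrier (presented_group X R)"
    by (simp only: mult_presented_group append_in_lists_conv pres_class_carrier)
next
  fix x y z assume "x \<in> carrier (presented_group X R)" "y \<in> carrier (presented_group X R)"
    "z \<in> carrier (presented_group X R)"
  then obtain p q r where "p \<in> lists (X \<times> UNIV)" "x = pres_class X R p"
    "q \<in> lists (X \<times> UNIV)" "y = pres_class X R q" "r \<in> lists (X \<times> UNIV)" "z = pres_class X R r"
    unfolding carrier_presented_group by blast
  then show "x \<otimes>\<^bsub>presented_group X R\<^esub> y \<otimes>\<^bsub>presented_group X R\<^esub> z
      = x \<otimes>\<^bsub>presented_group X R\<^esub> (y \<otimes>\<^bsub>presented_group X R\<^esub> z)"
    by (simp only: mult_presented_group append_in_lists_conv append_assoc)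
next
  show "\<one>\<^bsub>presented_group X R\<^esub> \<in> carrier (presented_group X R)"
    unfolding carrier_presented_group one_presented_group by blast
next
  fix x assume "x \<in> carrier (presented_group X R)"
  then obtain w where "w \<in> lists (X \<times> UNIV)" "x = pres_class X R w"
    unfolding carrier_presented_group by blast
  then show "\<one>\<^bsub>presented_group X R\<^esub> \<otimes>\<^bsub>presented_group X R\<^esub> x = x"
    by (simp only: mult_presented_group one_presented_group lists.Nil append_Nil)
qed

lemma inv_presented_group:
  assumes "w \<in> lists (X \<times> UNIV)"
  shows "inv\<^bsub>presented_group X R\<^esub> pres_class X R w = pres_class X R (inv_word w)"
proof (rule group.inv_equality[OF group_presented_group])
  show "pres_class X R (inv_word w) \<otimes>\<^bsub>presented_group X R\<^esub> pres_class X R w = \<one>\<^bsub>presented_group X R\<^esub>"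
    using assms inv_word_lists[OF assms] pres_class_eq[OF inv_word_cancel[OF assms]]
    by (simp only: mult_presented_group one_presented_group)
qed (intro pres_class_carrier inv_word_lists assms)+

text \<open>\<open>pres_hom\<close> and \<open>exp_sum\<close> take the common value over all words
  of a class; this reduces both to invariance under the congruence.\<close>

lemma the_elem_pres_class:
  assumes "w \<in> lists (X \<times> UNIV)" "\<And>v. pres_cong X R w v \<Longrightarrow> f v = c"
  shows "the_elem (f ` pres_class X R w) = c"
proof -
  have "f v = c" if "v \<in> pres_class X R w" for v
    using that assms(2) by (simp add: pres_rel_iff)
  then have "f ` pres_class X R w = {c}"
    using pres_class_self[OF assms(1)] by blast
  then show ?thesis by simp
qed

end

section \<open>Evaluation of words in a monoid\<close>

lemma eval_word_Nil [simp]: "eval_word M \<phi> [] = \<one>\<^bsub>M\<^esub>"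
  by (simp add: eval_word_def)

lemma eval_word_Cons [simp]:
  "eval_word M \<phi> ((g, s) # w) = (if s then \<phi> g else inv\<^bsub>M\<^esub> (\<phi> g)) \<otimes>\<^bsub>M\<^esub> eval_word M \<phi> w"
  by (simp add: eval_word_def)

lemma eval_word_closed:
  assumes "Group.monoid M" "\<And>g. g \<in> X \<Longrightarrow> \<phi> g \<in> Units M" "w \<in> lists (X \<times> UNIV)"
  shows "eval_word M \<phi> w \<in> carrier M"
proof -
  interpret Group.monoid M by fact
  from assms(3) show ?thesis
  proof (induction w)
    case (Cons l w)
    then show ?case using assms(2) by (cases l) auto
  qed simp
qed

text \<open>Meant for the projection onto the Temperley-Lieb quotient. The values are required to be
  units because \<open>inv\<close> is defined by description, and h is only known to respect
  inverses that exist.\<close>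

lemma eval_word_hom:
  assumes "Group.monoid M" "Group.monoid N" "h \<in> hom M N" "h \<one>\<^bsub>M\<^esub> = \<one>\<^bsub>N\<^esub>"
    and \<phi>: "\<And>g. g \<in> X \<Longrightarrow> \<phi> g \<in> Units M" and w: "w \<in> lists (X \<times> UNIV)"
  shows "eval_word N (\<lambda>g. h (\<phi> g)) w = h (eval_word M \<phi> w)"
proof -
  interpret M: Group.monoid M by fact
  interpret N: Group.monoid N by fact
  note hm = hom_mult[OF assms(3)] 
  have inv: "inv\<^bsub>N\<^esub> (h x) = h (inv\<^bsub>M\<^esub> x)" if "x \<in> Units M" for x
    using that M.Units_closed[OF that] assms(4) hm[of x "inv\<^bsub>M\<^esub> x"] hm[of "inv\<^bsub>M\<^esub> x" x]
    by (intro N.inv_char) (simp_all add: hom_in_carrier[OF assms(3)])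
  from w show ?thesis
  proof (induction w)
    case (Cons l w)
    obtain g s where l: "l = (g, s)" by (cases l)
    have "\<phi> g \<in> Units M" "eval_word M \<phi> w \<in> carrier M"
      using Cons \<phi> eval_word_closed[OF assms(1), of X \<phi> w] l by auto
    then show ?case using Cons l M.Units_closed[of "\<phi> g"] by (simp add: inv hm)
  qed (simp add: assms(4))
qed

section \<open>Framed braid words and their exponent sum\<close>

lemma word_exp_append [simp]: "word_exp (v @ w) = word_exp v + word_exp w"
  and word_exp_Nil [simp]: "word_exp [] = 0"
  by (simp_all add: word_exp_def)

lemma word_exp_Cons: "word_exp ((g, s) # w) =
    (case g of Braiding i \<Rightarrow> if s then 1 else - 1 | _ \<Rightarrow> 0) + word_exp w"
  by (simp add: word_exp_def)

lemma word_exp_inv_word: "word_exp (inv_word w) = - word_exp w"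
proof (induction w)
  case (Cons l w)
  then show ?case by (cases l) (auto simp: inv_word_def word_exp_Cons split: gen.splits)
qed (simp add: inv_word_def)

text \<open>Framings and loops count zero, so t_j^d = 1 is harmless, and the other relations are
  homogeneous in the braiding letters.\<close>

lemma word_exp_rels: "(l, r) \<in> framed_rels d n \<Longrightarrow> word_exp (pos_word l) = word_exp (pos_word r)"
  by (induction rule: framed_rels.induct) (simp_all add: word_exp_Cons, simp add: word_exp_def sum_list_replicate)

lemma fbraid_rels_words:
  assumes "(l, r) \<in> fbraid_rels d n"
  shows "l \<in> lists (gens n \<times> UNIV) \<and> r \<in> lists (gens n \<times> UNIV)"
  using assms framed_rels_gens by (fastforce simp: fbraid_rels_def)

lemma pres_cong_word_exp: "pres_cong (gens n) (fbraid_rels d n) v w \<Longrightarrow> word_exp v = word_exp w"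
proof (induction rule: pres_cong.induct)
  case (pc_cancel a b g s)
  then show ?case by (simp add: word_exp_Cons split: gen.splits)
next
  case (pc_rel a b l r)
  then show ?case using word_exp_rels by (auto simp: fbraid_rels_def)
qed simp_all

lemma pres_cong_Suc:
  "pres_cong (gens n) (fbraid_rels d n) v w \<Longrightarrow> pres_cong (gens (Suc n)) (fbraid_rels d (Suc n)) v w"
proof (induction rule: pres_cong.induct)
  case (pc_refl w)
  then show ?case using gens_Suc[of n] by (intro pres_cong.pc_refl) auto
next
  case (pc_cancel a b g s)
  then show ?case using gens_Suc[of n] by (intro pres_cong.pc_cancel) auto
next
  case (pc_rel a b l r)
  then show ?case using gens_Suc[of n] framed_rels_Suc[of d n] by (intro pres_cong.pc_rel) (auto simp: fbraid_rels_def)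
qed (auto intro: pres_cong.pc_sym pres_cong.pc_trans)

abbreviation fbraid_class :: "nat \<Rightarrow> nat \<Rightarrow> (gen \<times> bool) list \<Rightarrow> fbraid" where
  "fbraid_class d n w \<equiv> pres_class (gens n) (fbraid_rels d n) w"

abbreviation fwords :: "nat \<Rightarrow> (gen \<times> bool) list set" where
  "fwords n \<equiv> lists (gens n \<times> UNIV)"

lemma fbraid_mult: "v \<in> fwords n \<Longrightarrow> w \<in> fwords n \<Longrightarrow>
    fbraid_class d n v \<otimes>\<^bsub>fbraid_group d n\<^esub> fbraid_class d n w = fbraid_class d n (v @ w)"
  unfolding fbraid_group_def by (rule mult_presented_group[OF fbraid_rels_words])

lemma fbraid_inv: "w \<in> fwords n \<Longrightarrow>
    inv\<^bsub>fbraid_group d n\<^esub> fbraid_class d n w = fbraid_class d n (inv_word w)"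
  unfolding fbraid_group_def by (rule inv_presented_group[OF fbraid_rels_words])

lemma fbraid_carrierE:
  assumes "\<alpha> \<in> carrier (fbraid_group d n)"
  obtains w where "w \<in> fwords n" "\<alpha> = fbraid_class d n w"
proof -
  have "\<alpha> \<in> (\<lambda>w. fbraid_class d n w) ` fwords n"
    using assms carrier_presented_group[of "fbraid_rels d n" "gens n", OF fbraid_rels_words]
    unfolding fbraid_group_def by simp
  then show thesis by (rule imageE) (intro that)
qed

lemma exp_sum_class: "w \<in> fwords n \<Longrightarrow> exp_sum (fbraid_class d n w) = word_exp w"
  unfolding exp_sum_def by (intro the_elem_pres_class[OF fbraid_rels_words]) (auto dest: pres_cong_word_exp)

lemma fwords_Suc: "w \<in> fwords n \<Longrightarrow> w \<in> fwords (Suc n)"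
  using gens_Suc[of n] by auto

lemma fbraid_incl_class:
  assumes "w \<in> fwords n"
  shows "fbraid_incl d n (fbraid_class d n w) = fbraid_class d (Suc n) w"
proof -
  have "fbraid_class d (Suc n) v = fbraid_class d (Suc n) w" if "v \<in> fbraid_class d n w" for v
  proof -
    have "pres_cong (gens n) (fbraid_rels d n) w v" using that by (simp add: pres_rel_iff)
    from pres_class_eq[OF fbraid_rels_words pres_cong_Suc[OF this]] show ?thesis by (rule sym)
  qed
  moreover have "w \<in> fbraid_class d n w"
    by (rule pres_class_self[OF fbraid_rels_words assms])
  ultimately show ?thesis
    unfolding fbraid_incl_def Suc_eq_plus1[symmetric] by (intro SUP_eq_const) blast+
qed

context framing_modulus
begin

section \<open>Images of braid words in the two algebras\<close>

definition letter_el :: "gen \<times> bool \<Rightarrow> free_el" where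
  "letter_el l = (if snd l then gen_el (fst l) else inv_el (fst l))"

definition word_el :: "(gen \<times> bool) list \<Rightarrow> free_el" where
  "word_el w = prod_list (map letter_el w)"

lemma word_el_append [simp]: "word_el (v @ w) = word_el v * word_el w"
  and word_el_Nil [simp]: "word_el [] = 1"
  and word_el_Cons: "word_el (l # w) = letter_el l * word_el w"
  by (simp_all add: word_el_def)

lemma letter_el_free_on: "1 \<le> n \<Longrightarrow> fst l \<in> gens n \<Longrightarrow> letter_el l \<in> free_on n"
  by (simp add: letter_el_def inv_el_free_on)

lemma word_el_free_on: "1 \<le> n \<Longrightarrow> w \<in> fwords n \<Longrightarrow> word_el w \<in> free_on n"
  by (induction w) (auto simp: word_el_Cons letter_el_free_on)

lemma word_el_pos_word: "word_el (pos_word w) = word_mono w"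
proof (induction w)
  case (Cons g w)
  then show ?case by (subst word_mono_Cons) (simp add: word_el_Cons letter_el_def)
qed simp

text \<open>Well-definedness of the map from braids to the algebra, checked on representatives: the
  group relations are among those of the algebra, and free cancellation is
  \<open>gen_inv_el\<close>.\<close>

lemma pres_cong_word_el:
  assumes "1 \<le> n" "pres_cong (gens n) (fbraid_rels d n) v w"
  shows "word_el v \<approx>[n] word_el w"
  using assms(2)
proof (induction rule: pres_cong.induct)
  case (pc_refl w)
  then show ?case using assms(1) by (simp add: cong_refl word_el_free_on)
next
  case (pc_cancel a b g s)
  have "letter_el (g, s) * letter_el (g, \<not> s) \<approx>[n] 1"
    using gen_inv_el[OF assms(1) pc_cancel(3)] by (cases s) (simp_all add: letter_el_def)
  from cong_ctx[OF this, of "word_el a" "word_el b"] show ?case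
    using pc_cancel assms(1) by (simp add: word_el_free_on word_el_Cons mult.assoc)
next
  case (pc_rel a b l r)
  then obtain l' r' where "l = pos_word l'" "r = pos_word r'" "(l', r') \<in> framed_rels d n"
    by (auto simp: fbraid_rels_def)
  then show ?case
    using cong_ctx[OF rel_word[OF _ assms(1)], of l' r' "word_el a" "word_el b"] pc_rel assms(1)
    by (simp add: word_el_free_on word_el_pos_word mult.assoc)
qed (auto intro: cong_sym cong_trans)

lemma yok_gen_Units:
  assumes "1 \<le> n" "g \<in> gens n"
  shows "yok_gen d n g \<in> Units (yokonuma d n)"
  unfolding Units_def yok_gen_def using assms gen_inv_el[OF assms, THEN yok_class_eq]
  by (auto simp: yok_class_carrier inv_el_free_on yok_class_mult yok_class_one
      intro!: bexI[of _ "yok_class d n (inv_el g)"])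

lemma eval_word_yokonuma:
  assumes n: "1 \<le> n" and w: "w \<in> fwords n"
  shows "eval_word (yokonuma d n) (yok_gen d n) w = yok_class d n (word_el w)"
  using w
proof (induction w)
  case (Cons l w)
  obtain g s where l: "l = (g, s)" by (cases l)
  have "(if s then yok_gen d n g else inv\<^bsub>yokonuma d n\<^esub> yok_gen d n g) = yok_class d n (letter_el l)"
    using yok_gen_inv[OF n, of g] Cons l by (simp add: letter_el_def yok_gen_def)
  moreover have "letter_el l \<in> free_on n" "word_el w \<in> free_on n"
    using Cons l n by (simp_all add: letter_el_free_on word_el_free_on)
  ultimately show ?case using Cons n by (simp add: l word_el_Cons yok_class_mult)
qed (simp add: yok_class_one)

lemma yok_hom_class:
  assumes "1 \<le> n" "w \<in> fwords n"
  shows "yok_hom d n (fbraid_class d n w) = yok_class d n (word_el w)"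
  unfolding yok_hom_def pres_hom_def
proof (rule the_elem_pres_class[OF fbraid_rels_words assms(2)])
  fix v assume v: "pres_cong (gens n) (fbraid_rels d n) w v"
  then have "v \<in> fwords n" using pres_cong_words[OF fbraid_rels_words v] by simp
  then show "eval_word (yokonuma d n) (yok_gen d n) v = yok_class d n (word_el w)"
    using eval_word_yokonuma[OF assms(1)] yok_class_eq[OF pres_cong_word_el[OF assms(1) v]] by simp
qed

lemma r_B_free_on: "2 \<le> n \<Longrightarrow> r_B d \<in> free_on n"
  by (simp add: r_B_def)

lemma r_TL_free_on: "3 \<le> n \<Longrightarrow> r_TL d \<in> free_on n"
  by (simp add: r_TL_def)

lemma ftl_ideal_ideal:
  assumes "1 \<le> n"
  shows "ideal (ftl_ideal d n) (yokonuma d n)"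
  unfolding ftl_ideal_def using assms
  by (intro ring.genideal_ideal ring_yokonuma) (auto simp: yok_class_carrier r_B_free_on r_TL_free_on)

text \<open>The projection is a ring homomorphism and so commutes with the evaluation of words. An
  induced trace therefore takes on a braid the value that \<open>Tr\<close> has on its image one
  level below.\<close>

lemma ftl_hom_class:
  assumes n: "1 \<le> n" and w: "w \<in> fwords n"
  shows "ftl_hom d n (fbraid_class d n w) = ftl_class d n (yok_class d n (word_el w))"
  unfolding ftl_hom_def pres_hom_def
proof (rule the_elem_pres_class[OF fbraid_rels_words w])
  fix v assume v: "pres_cong (gens n) (fbraid_rels d n) w v"
  then have vW: "v \<in> fwords n" using pres_cong_words[OF fbraid_rels_words v] by simp
  have h: "ftl_class d n \<in> ring_hom (yokonuma d n) (yokonuma d n Quot ftl_ideal d n)"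
    using ideal.rcos_ring_hom[OF ftl_ideal_ideal[OF n]] by (simp add: ftl_class_def[abs_def])
  have "eval_word (ftl d n) (\<lambda>g. ftl_class d n (yok_gen d n g)) v =
      ftl_class d n (eval_word (yokonuma d n) (yok_gen d n) v)"
  proof (rule eval_word_hom[OF _ _ _ _ yok_gen_Units[OF n] vW])
    show "Group.monoid (yokonuma d n)"
      using ring_yokonuma[OF n] by (simp add: ring_def)
    show "Group.monoid (ftl d n)"
      using ring_quot_algebra[OF ftl_ideal_ideal[OF n]] by (simp add: ftl_def ring_def)
    show "ftl_class d n \<in> hom (yokonuma d n) (ftl d n)"
      "ftl_class d n \<one>\<^bsub>yokonuma d n\<^esub> = \<one>\<^bsub>ftl d n\<^esub>"
      using h by (auto simp: ring_hom_def hom_def ftl_def quot_algebra_sel)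
  qed
  then show "eval_word (ftl d n) (\<lambda>g. ftl_class d n (yok_gen d n g)) v = ftl_class d n (yok_class d n (word_el w))"
    using eval_word_yokonuma[OF n vW] yok_class_eq[OF pres_cong_word_el[OF n v]] by simp
qed

end

section \<open>Normalisation and Markov moves\<close>

context special_trace
begin

text \<open>The origin of z and of the normalisation. With a factor L per added strand, the two
  stabilizations demand L u^2 z = 1 and L u^(-2) (z - (u - 1/u) E) = 1. Equating them gives z (u^4 -
  1) = -(u - 1/u) E, that is z = -E / (u (u^2 + 1)), and then L = 1 / (u^2 z).\<close>

lemma stabilization_factors:
  "- ((1 + ind_u ^ 2) / (E_par S * ind_u)) * ind_u ^ 2 * z_par S = 1"
  "- ((1 + ind_u ^ 2) / (E_par S * ind_u)) * inverse (ind_u ^ 2) *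
     (z_par S - (ind_u - inverse ind_u) * E_par S) = 1"
proof -
  define N :: cuv where "N = of_nat (card S)"
  define D where "D = 1 + ind_u ^ 2"
  have N: "N \<noteq> 0" using card_S by (simp add: N_def)
  have D: "D \<noteq> 0" by (simp add: D_def)
  have z: "z_par S = - (1 / (ind_u * D * N))" and E: "E_par S = 1 / N"
    by (simp_all add: z_par_def E_par_def N_def D_def add.commute)
  show "- ((1 + ind_u ^ 2) / (E_par S * ind_u)) * ind_u ^ 2 * z_par S = 1"
    unfolding z E D_def[symmetric] using N D by (simp add: field_simps power2_eq_square)
  have "z_par S - (ind_u - inverse ind_u) * E_par S = - (1 + (ind_u ^ 2 - 1) * D) / (ind_u * D * N)"
    unfolding z E using N D by (simp add: field_simps power2_eq_square)
  also have "1 + (ind_u ^ 2 - 1) * D = ind_u ^ 4"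
    by (simp add: D_def algebra_simps flip: power_add)
  finally have "z_par S - (ind_u - inverse ind_u) * E_par S = - (ind_u ^ 4) / (ind_u * D * N)" .
  then show "- ((1 + ind_u ^ 2) / (E_par S * ind_u)) * inverse (ind_u ^ 2) *
     (z_par S - (ind_u - inverse ind_u) * E_par S) = 1"
    unfolding E D_def[symmetric] using N D by (simp add: field_simps power2_eq_square power4_eq_xxxx)
qed

text \<open>\<open>T\<close> is kept abstract so that the trace on the Yokonuma-Hecke algebra and
  the one induced on the quotient are treated at once.\<close>

lemma rho_B_invariant:
  assumes T: "\<And>n w. 1 \<le> n \<Longrightarrow> w \<in> fwords n \<Longrightarrow> T n (fbraid_class d n w) = tau n (word_el w)"
  shows "solid_torus_invariant d (rho_B S T)"
proof -
  define L where "L = - ((1 + ind_u ^ 2) / (E_par S * ind_u))"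
  have rho: "rho_B S T (n, fbraid_class d n w) = L ^ (n - 1) * ind_u powi (2 * word_exp w) * tau n (word_el w)"
    if "1 \<le> n" "w \<in> fwords n" for n w
    using that by (simp add: rho_B_def T exp_sum_class L_def)
  have move: "rho_B S T p = rho_B S T q" if "markov_move d p q" for p q
    using that
  proof cases
    case (conjugation n \<alpha> \<gamma>)
    obtain v where v: "v \<in> fwords n" "\<alpha> = fbraid_class d n v"
      using conjugation(4) by (rule fbraid_carrierE)
    obtain w where w: "w \<in> fwords n" "\<gamma> = fbraid_class d n w"
      using conjugation(5) by (rule fbraid_carrierE)
    note iw = inv_word_lists[OF w(1)]
    have F: "word_el v \<in> free_on n" "word_el w \<in> free_on n" "word_el (inv_word w) \<in> free_on n"
      using conjugation v w iw by (simp_all add: word_el_free_on)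
    have q: "q = (n, fbraid_class d n (w @ v @ inv_word w))"
      using v w iw conjugation by (simp add: fbraid_mult fbraid_inv append_in_lists_conv del: in_lists_conv_set)
    have "word_el (inv_word w) * word_el w \<approx>[n] 1"
      using pres_cong_word_el[OF conjugation(3) inv_word_cancel[OF fbraid_rels_words w(1)]] by simp
    then have "tau n (word_el v * (word_el (inv_word w) * word_el w)) = tau n (word_el v * 1)"
      using F by (intro tau_cong cong_mult_left)
    then have "tau n (word_el (w @ v @ inv_word w)) = tau n (word_el v)"
      using tau_commute[OF conjugation(3), of "word_el w" "word_el v * word_el (inv_word w)"] F by (simp add: mult.assoc)
    then show ?thesis
      unfolding q conjugation(1) v(2) using v(1) w(1) iw conjugation(3)
      by (simp add: rho word_exp_inv_word append_in_lists_conv del: in_lists_conv_set)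
  next
    case (stab_pos n \<alpha>)
    obtain w where w: "w \<in> fwords n" "\<alpha> = fbraid_class d n w"
      using stab_pos(4) by (rule fbraid_carrierE)
    have l: "[(Braiding n, True)] \<in> fwords (Suc n)" using stab_pos by simp
    have q: "q = (Suc n, fbraid_class d (Suc n) (w @ [(Braiding n, True)]))"
      using stab_pos w l fwords_Suc[OF w(1)]
      by (simp add: fbraid_incl_class fbraid_gen_def fbraid_mult del: in_lists_conv_set)
    \<comment> \<open>The new strand raises the power of L from n - 1 to n, and the new letter adds
      1 to the exponent sum, hence the factor u^2.\<close>
    have "rho_B S T q = L ^ n * (ind_u powi (2 * word_exp w) * ind_u ^ 2) * (z_par S * tau n (word_el w))"
      using stab_pos w l fwords_Suc[OF w(1)] unfolding q
      by (subst rho) (simp_all add: word_el_Cons letter_el_def tau_g word_el_free_on word_exp_Cons append_in_lists_conv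
          power_int_add distrib_left del: in_lists_conv_set)
    also have "\<dots> = (L * ind_u ^ 2 * z_par S) * (L ^ (n - 1) * ind_u powi (2 * word_exp w) * tau n (word_el w))"
      using stab_pos by (simp add: power_eq_if mult_ac)
    finally show ?thesis
      unfolding stabilization_factors(1)[folded L_def] stab_pos(1) w(2) using stab_pos(3) w(1) by (simp add: rho)
  next
    case (stab_neg n \<alpha>)
    obtain w where w: "w \<in> fwords n" "\<alpha> = fbraid_class d n w"
      using stab_neg(4) by (rule fbraid_carrierE)
    have l: "[(Braiding n, True)] \<in> fwords (Suc n)" "[(Braiding n, False)] \<in> fwords (Suc n)"
      using stab_neg by simp_all
    have q: "q = (Suc n, fbraid_class d (Suc n) (w @ [(Braiding n, False)]))"
      using stab_neg w l fwords_Suc[OF w(1)]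
      by (simp add: fbraid_incl_class fbraid_gen_def fbraid_inv fbraid_mult inv_word_def del: in_lists_conv_set)
    let ?c = "z_par S - (ind_u - inverse ind_u) * E_par S"
    have "rho_B S T q = L ^ n * (ind_u powi (2 * word_exp w) * inverse (ind_u ^ 2)) * (?c * tau n (word_el w))"
      using stab_neg w l fwords_Suc[OF w(1)] unfolding q
      by (subst rho) (simp_all add: word_el_Cons letter_el_def inv_el_def tau_g_inv word_el_free_on word_exp_Cons
          append_in_lists_conv power_int_diff right_diff_distrib divide_inverse del: in_lists_conv_set)
    also have "\<dots> = (L * inverse (ind_u ^ 2) * ?c) * (L ^ (n - 1) * ind_u powi (2 * word_exp w) * tau n (word_el w))"
      using stab_neg by (simp add: power_eq_if mult_ac)
    finally show ?thesis
      unfolding stabilization_factors(2)[folded L_def] stab_neg(1) w(2) using stab_neg(3) w(1) by (simp add: rho)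
  qed
  have "rho_B S T p = rho_B S T q" if "equivclp (markov_move d) p q" for p q
    using that by (induction rule: equivclp_induct) (auto dest: move)
  then show ?thesis by (simp add: solid_torus_invariant_def)
qed

end

theorem mainTheorem3:
  fixes d :: nat and S S3 S4 :: "nat set" and Tr :: "nat \<Rightarrow> free_el set \<Rightarrow> cuv"
  assumes "d \<ge> 1"
    and "S \<subseteq> {..<d}" and "0 \<in> S"
    and "S3 \<subseteq> S - {0}" and "S4 \<subseteq> S - {0}" and "S3 \<inter> S4 = {}"
    and "markov_trace d (z_par S) (x_par d S) (y_par d S S3 S4) Tr"
  shows "solid_torus_invariant d (rho_B S (\<lambda>n \<alpha>. Tr n (yok_hom d n \<alpha>))) \<and>
    (\<forall>tr. induced_on_ftl d Tr tr \<longrightarrow>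
      solid_torus_invariant d (rho_B S (\<lambda>n \<alpha>. tr n (ftl_hom d n \<alpha>))))"
proof -
  interpret special_trace d S S3 S4 Tr
    using assms by unfold_locales
  show ?thesis
  proof (intro conjI allI impI)
    show "solid_torus_invariant d (rho_B S (\<lambda>n \<alpha>. Tr n (yok_hom d n \<alpha>)))"
      by (intro rho_B_invariant) (simp add: yok_hom_class tau_def)
    fix tr assume "induced_on_ftl d Tr tr"
    then show "solid_torus_invariant d (rho_B S (\<lambda>n \<alpha>. tr n (ftl_hom d n \<alpha>)))"
      by (intro rho_B_invariant) (simp add: ftl_hom_class tau_def induced_on_ftl_def yok_class_carrier word_el_free_on)
  qed
qed

end
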